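(* Let $\mathcal{R}$ be the super-Virasoro algebra of Ramond type. Let $M$ be an $\mathcal{R}$-module such that the restriction of $M$ as a $U(\mathfrak{h})$-module is free of rank $1$. Then up to a parity, $M\cong\Omega_{\mathcal{R}}(\lambda,\alpha)$ for some $\lambda\in\mathbb{C}^*$ and $\alpha\in\mathbb{C}$; that is, there exist $\lambda\in\mathbb{C}^*$ and $\alpha\in\mathbb{C}$ such that $M\cong\Omega_{\mathcal{R}}(\lambda,\alpha)$ or $M\cong\Pi(\Omega_{\mathcal{R}}(\lambda,\alpha))$ as $\mathcal{R}$-modules.
   Context: All spaces are over $\mathbb{C}$; $\mathbb{C}^*$ is the set of nonzero complex numbers. The Ramond algebra $\mathcal{R}$ (super-Virasoro algebra of Ramond type, without center) is the Lie superalgebra whose even part has basis $\{L_n\mid n\in\mathbb{Z}\}$ and whose odd part has basis $\{G_r\mid r\in\mathbb{Z}\}$, with brackets $[L_m,L_n]=(m-n)L_{m+n}$, $[L_m,G_r]=(\frac m2-r)G_{m+r}$, $[G_r,G_s]=2L_{r+s}$. Its canonical Cartan subalgebra is $\mathfrak{h}=\mathbb{C}L_0\oplus\mathbb{C}G_0$, and $U(\mathfrak{h})$ is its universal enveloping algebra; since $L_0G_0=G_0L_0$ and $G_0^2=L_0$, $U(\mathfrak{h})=\mathbb{C}[L_0]\oplus G_0\mathbb{C}[L_0]$. A module over a Lie superalgebra $A$ always means a supermodule $M=M_{\bar 0}\oplus M_{\bar 1}$ with $A_{\bar i}\cdot M_{\bar j}\subseteq M_{\bar i+\bar j}$; $\cong$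 denotes (parity-preserving) isomorphism of supermodules. $\Pi(M)$ is the module with the same underlying space and action as $M$ and with parity exchanged: $(\Pi(M))_{\bar 0}=M_{\bar 1}$, $(\Pi(M))_{\bar 1}=M_{\bar 0}$. For $\lambda\in\mathbb{C}^*$, $\alpha\in\mathbb{C}$, $\Omega_{\mathcal{R}}(\lambda,\alpha)$ is the $\mathcal{R}$-module with underlying space $\mathbb{C}[x^2]\oplus x\mathbb{C}[x^2]$ (part $\bar 0$ is $\mathbb{C}[x^2]$, part $\bar 1$ is $x\mathbb{C}[x^2]$) and action, for $m\in\mathbb{Z}$ and $f(x^2)\in\mathbb{C}[x^2]$: $L_mf(x^2)=\lambda^m(x^2+m\alpha)f(x^2+m)$, $L_m\,xf(x^2)=\lambda^mx(x^2+m\alpha+\frac m2)f(x^2+m)$, $G_mf(x^2)=\lambda^mxf(x^2+m)$, $G_m\,xf(x^2)=\lambda^m(x^2+2m\alpha)f(x^2+m)$. *)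

theory Defs
  imports
    Complex_Main
    "HOL-Computational_Algebra.Polynomial"
    "HOL-Library.Poly_Mapping"
    "HOL-Library.Product_Plus"
    "HOL-Library.Z2"
    "HOL-Algebra.QuotRing"
begin

section \<open>Super vector spaces, Lie superalgebras and supermodules\<close>

text \<open>
  Parities are elements of the two-element field \<^typ>\<open>bit\<close>, so that parities add modulo 2.
  A super vector space is a pair of subspaces with zero intersection inside an ambient complex
  vector space; the space itself is their sum, which may be a proper subspace of the ambient one
  (this is how the Cartan subalgebra sits inside the Ramond algebra).
\<close>

record 'v superspace =
  scale :: "complex \<Rightarrow> 'v \<Rightarrow> 'v"
  part :: "bit \<Rightarrow> 'v set"

record 'g lie_superalg = "'g superspace" +
  bracket :: "'g \<Rightarrow> 'g \<Rightarrow> 'g"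

record ('g, 'm) supermod = "'m superspace" +
  act :: "'g \<Rightarrow> 'm \<Rightarrow> 'm"

definition underlying :: "('v::ab_group_add, 'z) superspace_scheme \<Rightarrow> 'v set" where
  "underlying V = {v + w | v w. v \<in> part V 0 \<and> w \<in> part V 1}"

definition superspace :: "('v::ab_group_add, 'z) superspace_scheme \<Rightarrow> bool" where
  "superspace V \<longleftrightarrow>
     vector_space (scale V) \<and> (\<forall>i. module.subspace (scale V) (part V i)) \<and>
     part V 0 \<inter> part V 1 = {0}"

definition bilinear_on ::
  "(complex \<Rightarrow> 'a \<Rightarrow> 'a) \<Rightarrow> 'a set \<Rightarrow> (complex \<Rightarrow> 'b \<Rightarrow> 'b) \<Rightarrow> 'b set \<Rightarrow>
   (complex \<Rightarrow> 'c \<Rightarrow> 'c) \<Rightarrow> ('a::ab_group_add \<Rightarrow> 'b::ab_group_add \<Rightarrow> 'c::ab_group_add) \<Rightarrow> bool" where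
  "bilinear_on sa A sb B sc f \<longleftrightarrow>
     (\<forall>x\<in>A. \<forall>y\<in>B.
        (\<forall>x'\<in>A. f (x + x') y = f x y + f x' y) \<and> (\<forall>y'\<in>B. f x (y + y') = f x y + f x y') \<and>
        (\<forall>c. f (sa c x) y = sc c (f x y) \<and> f x (sb c y) = sc c (f x y)))"

text \<open>The Koszul sign \<open>(-1)\<^sup>i\<^sup>j\<close>.\<close>

definition koszul :: "bit \<Rightarrow> bit \<Rightarrow> complex" where
  "koszul i j = (if i = 1 \<and> j = 1 then - 1 else 1)"

definition lie_superalgebra :: "'g::ab_group_add lie_superalg \<Rightarrow> bool" where
  "lie_superalgebra A \<longleftrightarrow>
     superspace A \<and>
     bilinear_on (scale A) (underlying A) (scale A) (underlying A) (scale A) (bracket A) \<and>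
     (\<forall>i j. \<forall>x\<in>part A i. \<forall>y\<in>part A j.
        bracket A x y \<in> part A (i + j) \<and>
        bracket A x y = - scale A (koszul i j) (bracket A y x)) \<and>
     (\<forall>i j k. \<forall>x\<in>part A i. \<forall>y\<in>part A j. \<forall>z\<in>part A k.
        bracket A x (bracket A y z) =
          bracket A (bracket A x y) z + scale A (koszul i j) (bracket A y (bracket A x z)))"

text \<open>The space of a supermodule is its whole type.\<close>

definition supermodule ::
  "'g::ab_group_add lie_superalg \<Rightarrow> ('g, 'm::ab_group_add) supermod \<Rightarrow> bool" where
  "supermodule A M \<longleftrightarrow>
     superspace M \<and> underlying M = UNIV \<and>
     bilinear_on (scale A) (underlying A) (scale M) UNIV (scale M) (act M) \<and>
     (\<forall>i j. \<forall>x\<in>part A i. \<forall>v\<in>part M j. act M x v \<in> part M (i + j)) \<and>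
     (\<forall>i j. \<forall>x\<in>part A i. \<forall>y\<in>part A j. \<forall>v.
        act M (bracket A x y) v =
          act M x (act M y v) - scale M (koszul i j) (act M y (act M x v)))"

definition isomorphic_supermodules ::
  "'g::ab_group_add lie_superalg \<Rightarrow> ('g, 'm::ab_group_add) supermod \<Rightarrow>
   ('g, 'n::ab_group_add) supermod \<Rightarrow> bool" where
  "isomorphic_supermodules A M N \<longleftrightarrow>
     (\<exists>\<phi>. Vector_Spaces.linear (scale M) (scale N) \<phi> \<and> bij \<phi> \<and>
        (\<forall>i. \<phi> ` part M i = part N i) \<and>
        (\<forall>x\<in>underlying A. \<forall>v. \<phi> (act M x v) = act N x (\<phi> v)))"

definition parity_change :: "('g, 'm) supermod \<Rightarrow> ('g, 'm) supermod" where
  "parity_change M = M\<lparr>part := (\<lambda>i. part M (i + 1))\<rparr>"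


section \<open>Universal enveloping algebras\<close>

text \<open>
  The universal enveloping algebra \<open>U(\<gg>)\<close> is presented as the free associative unital
  algebra on the set \<open>\<gg>\<close>, modulo the two-sided ideal that makes the inclusion of
  \<open>\<gg>\<close> linear and turns the bracket into the supercommutator.  Dividing out the
  linearity relations alone gives the tensor algebra of \<open>\<gg>\<close>.
  The free algebra consists of the finitely supported functions on words, with convolution
  product; words form a (noncommutative) monoid that is written additively, because this is
  what the product on \<^typ>\<open>'a \<Rightarrow>\<^sub>0 complex\<close> expects.
\<close>

datatype 'a free_word = Word (letters: "'a list")

instantiation free_word :: (type) monoid_add
begin

definition zero_free_word :: "'a free_word" where
  "0 = Word []"

definition plus_free_word :: "'a free_word \<Rightarrow> 'a free_word \<Rightarrow> 'a free_word" where
  "u + w = Word (letters u @ letters w)"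

instance
  by standard (simp_all add: zero_free_word_def plus_free_word_def)

end

definition pm_scale :: "complex \<Rightarrow> ('a \<Rightarrow>\<^sub>0 complex) \<Rightarrow> ('a \<Rightarrow>\<^sub>0 complex)" where
  "pm_scale c p = Poly_Mapping.map ((*) c) p"

definition free_algebra :: "'g set \<Rightarrow> ('g free_word \<Rightarrow>\<^sub>0 complex) ring" where
  "free_algebra S =
     \<lparr>carrier = {t. \<forall>w\<in>Poly_Mapping.keys t. set (letters w) \<subseteq> S},
      mult = (*), one = 1, zero = 0, add = (+)\<rparr>"

definition letter :: "'g \<Rightarrow> ('g free_word \<Rightarrow>\<^sub>0 complex)" where
  "letter x = Poly_Mapping.single (Word [x]) 1"

definition uea_relations :: "'g::ab_group_add lie_superalg \<Rightarrow> ('g free_word \<Rightarrow>\<^sub>0 complex) set" where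
  "uea_relations A =
     {letter (x + y) - letter x - letter y | x y. x \<in> underlying A \<and> y \<in> underlying A} \<union>
     {letter (scale A c x) - pm_scale c (letter x) | c x. x \<in> underlying A} \<union>
     {letter x * letter y - pm_scale (koszul i j) (letter y * letter x) - letter (bracket A x y)
        | i j x y. x \<in> part A i \<and> y \<in> part A j}"

text \<open>
  \<^const>\<open>genideal\<close> is the two-sided ideal generated by a set.  It is automatically stable under
  scalars, since these are elements of the free algebra.
\<close>

definition uea :: "'g::ab_group_add lie_superalg \<Rightarrow> ('g free_word \<Rightarrow>\<^sub>0 complex) set ring" where
  "uea A = (let F = free_algebra (underlying A) in F Quot (genideal F (uea_relations A)))"

text \<open>
  A supermodule over \<open>\<gg>\<close> is a module over the free algebra, a word acting by composition.
  This action descends to \<open>U(\<gg>)\<close>: all representatives of an element of the quotient act in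
  the same way.
\<close>

definition free_algebra_act ::
  "('g, 'm::ab_group_add) supermod \<Rightarrow> ('g free_word \<Rightarrow>\<^sub>0 complex) \<Rightarrow> 'm \<Rightarrow> 'm" where
  "free_algebra_act M t v =
     (\<Sum>w\<in>Poly_Mapping.keys t. scale M (Poly_Mapping.lookup t w) (foldr (act M) (letters w) v))"

definition uea_act ::
  "('g, 'm::ab_group_add) supermod \<Rightarrow> ('g free_word \<Rightarrow>\<^sub>0 complex) set \<Rightarrow> 'm \<Rightarrow> 'm" where
  "uea_act M X v = the_elem ((\<lambda>t. free_algebra_act M t v) ` X)"

text \<open>
  Free of rank 1 means that there is a basis consisting of one element.  The restriction of \<open>M\<close>
  to a subalgebra \<open>A\<close> needs no notation of its own, because \<open>A\<close> lives in the same type.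
\<close>

definition uea_free_of_rank_one ::
  "'g::ab_group_add lie_superalg \<Rightarrow> ('g, 'm::ab_group_add) supermod \<Rightarrow> bool" where
  "uea_free_of_rank_one A M \<longleftrightarrow> (\<exists>v. bij_betw (\<lambda>X. uea_act M X v) (carrier (uea A)) UNIV)"


section \<open>The Ramond algebra and its Cartan subalgebra\<close>

datatype ramond_gen = L int | G int

type_synonym ramond = "ramond_gen \<Rightarrow>\<^sub>0 complex"

definition lin_ext :: "(complex \<Rightarrow> 'v \<Rightarrow> 'v) \<Rightarrow> ('a \<Rightarrow> 'v) \<Rightarrow> ('a \<Rightarrow>\<^sub>0 complex) \<Rightarrow> 'v::ab_group_add" where
  "lin_ext s f x = (\<Sum>a\<in>Poly_Mapping.keys x. s (Poly_Mapping.lookup x a) (f a))"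

text \<open>The third equation is \<open>[G\<^sub>r, L\<^sub>m] = - [L\<^sub>m, G\<^sub>r]\<close>.\<close>

fun gen_bracket :: "ramond_gen \<Rightarrow> ramond_gen \<Rightarrow> ramond" where
  "gen_bracket (L m) (L n) = Poly_Mapping.single (L (m + n)) (of_int m - of_int n)"
| "gen_bracket (L m) (G r) = Poly_Mapping.single (G (m + r)) (of_int m / 2 - of_int r)"
| "gen_bracket (G r) (L m) = Poly_Mapping.single (G (m + r)) (- (of_int m / 2 - of_int r))"
| "gen_bracket (G r) (G s) = Poly_Mapping.single (L (r + s)) 2"

definition ramond_algebra :: "ramond lie_superalg" where
  "ramond_algebra =
     \<lparr>scale = pm_scale,
      part = (\<lambda>i. {x. Poly_Mapping.keys x \<subseteq> (if i = 0 then range L else range G)}),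
      bracket = (\<lambda>x y. lin_ext pm_scale (\<lambda>a. lin_ext pm_scale (gen_bracket a) y) x)\<rparr>"

definition cartan :: "ramond lie_superalg" where
  "cartan = ramond_algebra
     \<lparr>part := (\<lambda>i. Set.range (Poly_Mapping.single (if i = 0 then L 0 else G 0)))\<rparr>"


section \<open>The modules \<open>\<Omega>(\<lambda>, \<alpha>)\<close>\<close>

text \<open>
  The pair \<open>(f, g)\<close> of polynomials in \<open>t = x\<^sup>2\<close> stands for the element \<open>f(x\<^sup>2) + x g(x\<^sup>2)\<close> of
  \<open>\<complex>[x\<^sup>2] \<oplus> x \<complex>[x\<^sup>2]\<close>.
\<close>

definition shift :: "int \<Rightarrow> complex poly \<Rightarrow> complex poly" where
  "shift m f = pcompose f [:of_int m, 1:]"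

definition omega_scale :: "complex \<Rightarrow> complex poly \<times> complex poly \<Rightarrow> complex poly \<times> complex poly" where
  "omega_scale c = (\<lambda>(f, g). (smult c f, smult c g))"

fun omega_gen ::
  "complex \<Rightarrow> complex \<Rightarrow> ramond_gen \<Rightarrow> complex poly \<times> complex poly \<Rightarrow> complex poly \<times> complex poly" where
  "omega_gen l \<alpha> (L m) (f, g) =
     (smult (l powi m) ([:of_int m * \<alpha>, 1:] * shift m f),
      smult (l powi m) ([:of_int m * \<alpha> + of_int m / 2, 1:] * shift m g))"
| "omega_gen l \<alpha> (G m) (f, g) =
     (smult (l powi m) ([:2 * of_int m * \<alpha>, 1:] * shift m g),
      smult (l powi m) (shift m f))"

definition Omega :: "complex \<Rightarrow> complex \<Rightarrow> (ramond, complex poly \<times> complex poly) supermod" where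
  "Omega l \<alpha> =
     \<lparr>scale = omega_scale,
      part = (\<lambda>i. if i = 0 then {(f, 0) | f. True} else {(0, g) | g. True}),
      act = (\<lambda>x p. lin_ext omega_scale (\<lambda>a. omega_gen l \<alpha> a p) x)\<rparr>"


section \<open>Consistency of the definitions\<close>

text \<open>
  The Ramond algebra and its Cartan subalgebra are Lie superalgebras, supermodules restrict from
  the former to the latter, \<open>\<Omega>(\<lambda>, \<alpha>)\<close> is a supermodule, and the action of the universal
  enveloping algebra does not depend on representatives (\<open>uea_act_coset\<close>).
\<close>

lemma lookup_pm_scale [simp]: "Poly_Mapping.lookup (pm_scale c p) k = c * Poly_Mapping.lookup p k"
  unfolding pm_scale_def by transfer (simp add: when_def)

lemma vs_pm_scale: "vector_space (pm_scale :: complex \<Rightarrow> ('a \<Rightarrow>\<^sub>0 complex) \<Rightarrow> _)"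
  by standard (auto intro!: poly_mapping_eqI simp: lookup_add algebra_simps)

lemma vs_omega_scale: "vector_space omega_scale"
  by standard (auto simp: omega_scale_def smult_add_right smult_add_left split: prod.splits)

lemma keys_pm_scale: "Poly_Mapping.keys (pm_scale c p) \<subseteq> Poly_Mapping.keys p"
  by (auto simp: in_keys_iff)

lemma lin_ext_superset:
  assumes "vector_space s" "finite S" "Poly_Mapping.keys x \<subseteq> S"
  shows "lin_ext s f x = (\<Sum>a\<in>S. s (Poly_Mapping.lookup x a) (f a))"
proof -
  interpret vector_space s by fact
  show ?thesis unfolding lin_ext_def
    by (rule sum.mono_neutral_left) (use assms in \<open>auto simp: in_keys_iff\<close>)
qed

lemma lin_ext_add:
  assumes "vector_space s"
  shows "lin_ext s f (x + y) = lin_ext s f x + lin_ext s f y"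
proof -
  interpret vector_space s by fact
  let ?S = "Poly_Mapping.keys x \<union> Poly_Mapping.keys y"
  have "Poly_Mapping.keys (x + y) \<subseteq> ?S" by (rule Poly_Mapping.keys_add)
  then show ?thesis
    by (simp add: lin_ext_superset[OF assms, of ?S] lookup_add scale_left_distrib sum.distrib)
qed

lemma lin_ext_scale:
  assumes "vector_space s"
  shows "lin_ext s f (pm_scale c x) = s c (lin_ext s f x)"
proof -
  interpret vector_space s by fact
  have "lin_ext s f (pm_scale c x) = (\<Sum>a\<in>Poly_Mapping.keys x. s (Poly_Mapping.lookup (pm_scale c x) a) (f a))"
    by (rule lin_ext_superset[OF assms _ keys_pm_scale]) simp
  then show ?thesis
    by (simp add: lin_ext_def scale_sum_right)
qed

lemma lin_ext_single [simp]:
  assumes "vector_space s"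
  shows "lin_ext s f (Poly_Mapping.single a c) = s c (f a)"
proof -
  interpret vector_space s by fact
  show ?thesis by (simp add: lin_ext_def)
qed

lemma lin_ext_fun_add:
  assumes "vector_space s"
  shows "lin_ext s (\<lambda>a. f a + g a) x = lin_ext s f x + lin_ext s g x"
proof -
  interpret vector_space s by fact
  show ?thesis by (simp add: lin_ext_def scale_right_distrib sum.distrib)
qed

lemma lin_ext_fun_scale:
  assumes "vector_space s"
  shows "lin_ext s (\<lambda>a. s c (f a)) x = s c (lin_ext s f x)"
proof -
  interpret vector_space s by fact
  show ?thesis by (simp add: lin_ext_def scale_sum_right mult.commute)
qed

lemma pm_keys_induct [consumes 1, case_names zero single add]:
  fixes x :: "'a \<Rightarrow>\<^sub>0 complex"
  assumes "Poly_Mapping.keys x \<subseteq> S"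
    and "P 0" and "\<And>a c. a \<in> S \<Longrightarrow> P (Poly_Mapping.single a c)"
    and "\<And>x y. P x \<Longrightarrow> P y \<Longrightarrow> P (x + y)"
  shows "P x"
proof -
  have eq: "x = (\<Sum>a\<in>Poly_Mapping.keys x. Poly_Mapping.single a (Poly_Mapping.lookup x a))"
    by (rule poly_mapping_eqI) (simp add: lookup_sum lookup_single when_def in_keys_iff if_distrib sum.delta' cong: if_cong)
  have "P (\<Sum>a\<in>T. Poly_Mapping.single a (Poly_Mapping.lookup x a))" if "finite T" "T \<subseteq> S" for T
    using that by (induction T rule: finite_induct) (auto intro: assms)
  then show ?thesis using eq assms(1) by (metis finite_keys)
qed

abbreviation rbr where "rbr \<equiv> bracket ramond_algebra"

lemma rbr_eq: "rbr x y = lin_ext pm_scale (\<lambda>a. lin_ext pm_scale (gen_bracket a) y) x"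
  by (simp add: ramond_algebra_def)
lemma rbr_add1: "rbr (x + x') y = rbr x y + rbr x' y"
  by (simp add: rbr_eq lin_ext_add vs_pm_scale)
lemma rbr_add2: "rbr x (y + y') = rbr x y + rbr x y'"
  by (simp add: rbr_eq lin_ext_add vs_pm_scale lin_ext_fun_add)
lemma rbr_sc1: "rbr (pm_scale c x) y = pm_scale c (rbr x y)"
  by (simp add: rbr_eq lin_ext_scale vs_pm_scale)
lemma rbr_sc2: "rbr x (pm_scale c y) = pm_scale c (rbr x y)"
  by (simp add: rbr_eq lin_ext_scale[OF vs_pm_scale] lin_ext_fun_scale[OF vs_pm_scale])
lemma rbr_0 [simp]: "rbr 0 y = 0" "rbr y 0 = 0"
  using rbr_add1[of 0 0 y] rbr_add2[of y 0 0] by simp_all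
lemma pm_scale_single [simp]: "pm_scale c (Poly_Mapping.single a d) = Poly_Mapping.single a (c * d)"
  by (rule poly_mapping_eqI) (simp add: lookup_single when_def)
lemma rbr_single: "rbr (Poly_Mapping.single a c) (Poly_Mapping.single b d) = pm_scale (c * d) (gen_bracket a b)"
  by (simp add: rbr_eq vs_pm_scale) (rule poly_mapping_eqI, simp)
lemma pm_scale_0 [simp]: "pm_scale c 0 = 0" by (rule poly_mapping_eqI) simp
lemma pm_scale_add: "pm_scale c (x + y) = pm_scale c x + pm_scale c y"
  by (rule poly_mapping_eqI) (simp add: lookup_add algebra_simps)

abbreviation gpart :: "bit \<Rightarrow> ramond_gen set" where "gpart i \<equiv> (if i = 0 then Set.range L else Set.range G)"

lemma part_ramond: "part ramond_algebra i = {x. Poly_Mapping.keys x \<subseteq> gpart i}"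
  by (simp add: ramond_algebra_def)

lemma superspace_ramond: "superspace ramond_algebra"
proof -
  interpret vector_space "pm_scale :: complex \<Rightarrow> ramond \<Rightarrow> ramond" by (rule vs_pm_scale)
  have "subspace {x::ramond. Poly_Mapping.keys x \<subseteq> S}" for S
    unfolding subspace_def by (auto dest!: subsetD[OF Poly_Mapping.keys_add] subsetD[OF keys_pm_scale])
  moreover have "x = 0" if "Poly_Mapping.keys x \<subseteq> range L" "Poly_Mapping.keys x \<subseteq> range G" for x :: ramond
  proof -
    have "Poly_Mapping.keys x = {}" using that by blast
    then show ?thesis by simp
  qed
  ultimately show ?thesis
    unfolding superspace_def part_ramond
    using vector_space_axioms by (auto simp: ramond_algebra_def)
qed

lemma underlying_ramond: "underlying ramond_algebra = UNIV"
proof -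
  have "x \<in> underlying ramond_algebra" for x
  proof -
    have "Poly_Mapping.keys x \<subseteq> UNIV" by simp
    then show ?thesis
    proof (induction x rule: pm_keys_induct)
      case zero
      show ?case unfolding underlying_def part_ramond
        by (intro CollectI exI[of _ 0]) auto
    next
      case (single a c)
      show ?case
      proof (cases a)
        case (L m)
        then show ?thesis unfolding underlying_def part_ramond
          by (intro CollectI exI[of _ "Poly_Mapping.single a c"] exI[of _ 0]) (auto )
      next
        case (G m)
        then show ?thesis unfolding underlying_def part_ramond
          by (intro CollectI exI[of _ "Poly_Mapping.single a c"] exI[of _ 0]) (auto )
      qed
    next
      case (add x y)
      then obtain a b c d where "x = a + b" "y = c + d" "a \<in> part ramond_algebra 0" "c \<in> part ramond_algebra 0"
        "b \<in> part ramond_algebra 1" "d \<in> part ramond_algebra 1" unfolding underlying_def by blast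
      moreover have "a + c \<in> part ramond_algebra 0" "b + d \<in> part ramond_algebra 1"
        using calculation Poly_Mapping.keys_add[of a c] Poly_Mapping.keys_add[of b d] by (auto simp: part_ramond)
      moreover have "x + y = (a + c) + (b + d)" using calculation by simp
      ultimately show ?case unfolding underlying_def by blast
    qed
  qed
  then show ?thesis by blast
qed

lemma part_add: "x \<in> part ramond_algebra i \<Longrightarrow> y \<in> part ramond_algebra i \<Longrightarrow> x + y \<in> part ramond_algebra i"
  using Poly_Mapping.keys_add[of x y] by (auto simp: part_ramond split: if_splits)

lemma zero_part: "0 \<in> part ramond_algebra i" by (simp add: part_ramond)

lemma rbr_part: 
  assumes "x \<in> part ramond_algebra i" "y \<in> part ramond_algebra j"
  shows "rbr x y \<in> part ramond_algebra (i + j)"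
proof -
  have "Poly_Mapping.keys x \<subseteq> gpart i" using assms by (simp add: part_ramond)
  then show ?thesis
  proof (induction x rule: pm_keys_induct)
    case (single a c)
    have "Poly_Mapping.keys y \<subseteq> gpart j" using assms by (simp add: part_ramond)
    then show ?case
    proof (induction y rule: pm_keys_induct)
      case (single b d)
      then show ?case using \<open>a \<in> _\<close>
        by (cases i; cases j) (auto simp: rbr_single part_ramond range_eqI split: if_splits)
    qed (auto simp: rbr_add2 part_add zero_part)
  qed (auto simp: rbr_add1 part_add zero_part)
qed

lemma rbr_skew: 
  assumes "x \<in> part ramond_algebra i" "y \<in> part ramond_algebra j"
  shows "rbr x y = - pm_scale (koszul i j) (rbr y x)"
proof -
  have "Poly_Mapping.keys x \<subseteq> gpart i" using assms by (simp add: part_ramond)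
  then show ?thesis
  proof (induction x rule: pm_keys_induct)
    case (single a c)
    have "Poly_Mapping.keys y \<subseteq> gpart j" using assms by (simp add: part_ramond)
    then show ?case
    proof (induction y rule: pm_keys_induct)
      case (single b d)
      then show ?case using \<open>a \<in> _\<close>
        by (cases i; cases j)
          (auto simp: rbr_single koszul_def algebra_simps simp flip: single_uminus split: if_splits)
    qed (auto simp: rbr_add1 rbr_add2 pm_scale_add)
  qed (auto simp: rbr_add1 rbr_add2 pm_scale_add)
qed

lemma gen_jacobi:
  assumes "a \<in> gpart i" "b \<in> gpart j" "e \<in> gpart k"
  shows "rbr (Poly_Mapping.single a 1) (gen_bracket b e) =
    rbr (gen_bracket a b) (Poly_Mapping.single e 1) + pm_scale (koszul i j) (rbr (Poly_Mapping.single b 1) (gen_bracket a e))"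
proof -
  have eq: "Poly_Mapping.single g p = Poly_Mapping.single g' q + Poly_Mapping.single g'' r" 
    if "g' = g" "g'' = g" "p = q + r" for g g' g'' :: ramond_gen and p q r :: complex
    using that by (simp add: single_add)
  show ?thesis
    using assms
    by (cases i; cases j; cases a; cases b; cases e)
      (simp_all add: rbr_single koszul_def image_iff, 
       (rule eq; simp add: field_simps)+)
qed

lemma rbr_jacobi:
  assumes "x \<in> part ramond_algebra i" "y \<in> part ramond_algebra j" "z \<in> part ramond_algebra k"
  shows "rbr x (rbr y z) = rbr (rbr x y) z + pm_scale (koszul i j) (rbr y (rbr x z))"
proof -
  have "Poly_Mapping.keys x \<subseteq> gpart i" using assms by (simp add: part_ramond)
  then show ?thesis
  proof (induction x rule: pm_keys_induct)
    case (single a c)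
    have "Poly_Mapping.keys y \<subseteq> gpart j" using assms by (simp add: part_ramond)
    then show ?case
    proof (induction y rule: pm_keys_induct)
      case (single b d)
      have "Poly_Mapping.keys z \<subseteq> gpart k" using assms by (simp add: part_ramond)
      then show ?case
      proof (induction z rule: pm_keys_induct)
        case (single e f)
        have s1: "Poly_Mapping.single g h = pm_scale h (Poly_Mapping.single g 1)" for g :: ramond_gen and h by simp
        have s2: "pm_scale g (pm_scale h x) = pm_scale (g * h) x" for g h and x :: ramond
          by (rule poly_mapping_eqI) simp
        have "a \<in> gpart i" "b \<in> gpart j" by fact+
        from gen_jacobi[OF this \<open>e \<in> _\<close>] show ?case
          unfolding s1[of a c] s1[of b d] s1[of e f] rbr_sc1 rbr_sc2 s2
          by (simp add: rbr_single rbr_sc1 rbr_sc2 s2 pm_scale_add algebra_simps del: pm_scale_single)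
      qed (auto simp: rbr_add1 rbr_add2 pm_scale_add)
    qed (auto simp: rbr_add1 rbr_add2 pm_scale_add)
  qed (auto simp: rbr_add1 rbr_add2 pm_scale_add)
qed

lemma scale_ramond [simp]: "scale ramond_algebra = pm_scale" by (simp add: ramond_algebra_def)

lemma lie_superalgebra_ramond: "lie_superalgebra ramond_algebra"
  unfolding lie_superalgebra_def bilinear_on_def scale_ramond
  by (intro conjI allI ballI superspace_ramond rbr_add1 rbr_add2 rbr_sc1 rbr_sc2 rbr_part)
     (assumption | rule rbr_skew rbr_jacobi)+

lemma part_cartan: "part cartan i = Set.range (Poly_Mapping.single (if i = 0 then L 0 else G 0))"
  by (simp add: cartan_def)
lemma scale_cartan [simp]: "scale cartan = pm_scale" by (simp add: cartan_def)
lemma bracket_cartan [simp]: "bracket cartan = rbr" by (simp add: cartan_def)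
lemma part_cartan_subset: "part cartan i \<subseteq> part ramond_algebra i"
  by (auto simp: part_cartan part_ramond split: if_splits)
lemma underlying_cartan: "underlying cartan = {Poly_Mapping.single (L 0) a + Poly_Mapping.single (G 0) b | a b. True}"
  by (auto simp: underlying_def part_cartan)

lemma zero_in_range_single: "0 \<in> Set.range (Poly_Mapping.single a)"
  by (metis rangeI single_zero)

lemma superspace_cartan: "superspace cartan"
proof -
  interpret vector_space "pm_scale :: complex \<Rightarrow> ramond \<Rightarrow> ramond" by (rule vs_pm_scale)
  have "subspace (Set.range (Poly_Mapping.single g))" for g :: ramond_gen
    unfolding subspace_def by (auto simp flip: single_add) (metis rangeI single_zero)
  moreover have "part cartan 0 \<inter> part cartan 1 \<subseteq> {0}"
    using part_cartan_subset superspace_ramond unfolding superspace_def by blast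
  moreover have "0 \<in> part cartan 0 \<inter> part cartan 1"
    by (simp add: part_cartan zero_in_range_single)
  ultimately show ?thesis
    unfolding superspace_def by (auto simp: part_cartan vector_space_axioms)
qed

lemma lie_superalgebra_cartan: "lie_superalgebra cartan"
proof -
  have "rbr x y \<in> part cartan (i + j)" if "x \<in> part cartan i" "y \<in> part cartan j" for x y i j
    using that by (cases i; cases j) (auto simp: part_cartan rbr_single zero_in_range_single)
  moreover have "rbr x y = - pm_scale (koszul i j) (rbr y x)"
    if "x \<in> part cartan i" "y \<in> part cartan j" for x y i j
    using that part_cartan_subset by (blast intro: rbr_skew)
  moreover have "rbr x (rbr y z) = rbr (rbr x y) z + pm_scale (koszul i j) (rbr y (rbr x z))"
    if "x \<in> part cartan i" "y \<in> part cartan j" "z \<in> part cartan k" for x y z i j k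
    using that part_cartan_subset by (blast intro: rbr_jacobi)
  ultimately show ?thesis
    unfolding lie_superalgebra_def bilinear_on_def scale_cartan bracket_cartan
    by (intro conjI allI ballI superspace_cartan rbr_add1 rbr_add2 rbr_sc1 rbr_sc2)
qed

lemma supermodule_cartan:
  assumes "supermodule ramond_algebra M" shows "supermodule cartan M"
  using assms part_cartan_subset unfolding supermodule_def underlying_ramond
  by (simp add: subset_iff bilinear_on_def)

abbreviation oact where "oact l \<alpha> \<equiv> act (Omega l \<alpha>)"
lemma oact_eq: "oact l \<alpha> x p = lin_ext omega_scale (\<lambda>a. omega_gen l \<alpha> a p) x" by (simp add: Omega_def)
lemma scale_Omega [simp]: "scale (Omega l \<alpha>) = omega_scale" by (simp add: Omega_def)
lemma part_Omega: "part (Omega l \<alpha>) i = (if i = 0 then {(f, 0) | f. True} else {(0, g) | g. True})"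
  by (simp add: Omega_def)

lemma shift_simps: "shift m (f + g) = shift m f + shift m g" "shift m (smult c f) = smult c (shift m f)" "shift m 0 = 0"
  "shift m (f * g) = shift m f * shift m g" "shift m (pCons c f) = [:c:] + [:of_int m, 1:] * shift m f"
  by (simp_all add: shift_def pcompose_add pcompose_smult pcompose_mult pcompose_pCons)
lemma shift_shift: "shift m (shift n f) = shift (n + m) f"
  by (simp add: shift_def pcompose_assoc pcompose_pCons algebra_simps flip: pcompose_assoc)

lemma omega_gen_add: "omega_gen l \<alpha> a (p + q) = omega_gen l \<alpha> a p + omega_gen l \<alpha> a q"
  by (cases a; cases p; cases q) (simp_all add: shift_simps smult_add_right algebra_simps)
lemma omega_gen_scale: "omega_gen l \<alpha> a (omega_scale c p) = omega_scale c (omega_gen l \<alpha> a p)"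
  by (cases a; cases p) (simp_all add: shift_simps omega_scale_def smult_add_right algebra_simps)

lemma oact_add1: "oact l \<alpha> (x + y) p = oact l \<alpha> x p + oact l \<alpha> y p"
  by (simp add: oact_eq lin_ext_add vs_omega_scale)
lemma oact_sc1: "oact l \<alpha> (pm_scale c x) p = omega_scale c (oact l \<alpha> x p)"
  by (simp add: oact_eq lin_ext_scale vs_omega_scale)
lemma oact_add2: "oact l \<alpha> x (p + q) = oact l \<alpha> x p + oact l \<alpha> x q"
  by (simp add: oact_eq lin_ext_fun_add[OF vs_omega_scale] omega_gen_add)
lemma oact_sc2: "oact l \<alpha> x (omega_scale c p) = omega_scale c (oact l \<alpha> x p)"
  by (simp add: oact_eq lin_ext_fun_scale[OF vs_omega_scale] omega_gen_scale)
lemma oact_0 [simp]: "oact l \<alpha> 0 y = 0" "oact l \<alpha> x 0 = 0"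
  using oact_add1[of l \<alpha> 0 0 y] oact_add2[of l \<alpha> x 0 0] by simp_all
lemma oact_single: "oact l \<alpha> (Poly_Mapping.single a c) p = omega_scale c (omega_gen l \<alpha> a p)"
  by (simp add: oact_eq vs_omega_scale)

lemma superspace_Omega: "superspace (Omega l \<alpha>)"
proof -
  interpret vector_space omega_scale by (rule vs_omega_scale)
  show ?thesis unfolding superspace_def scale_Omega
    by (auto simp: vector_space_axioms part_Omega subspace_def omega_scale_def zero_prod_def)
qed

lemma oact_part: "x \<in> part ramond_algebra i \<Longrightarrow> v \<in> part (Omega l \<alpha>) j \<Longrightarrow> oact l \<alpha> x v \<in> part (Omega l \<alpha>) (i + j)"
proof -
  assume "x \<in> part ramond_algebra i" and v: "v \<in> part (Omega l \<alpha>) j"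
  then have "Poly_Mapping.keys x \<subseteq> gpart i" by (simp add: part_ramond)
  then show ?thesis
  proof (induction x rule: pm_keys_induct)
    case zero
    then show ?case by (auto simp: part_Omega zero_prod_def)
  next
    case (single a c)
    then show ?case using v
      by (cases i; cases j; cases v) (auto simp: oact_single part_Omega omega_scale_def shift_simps)
  next
    case (add x y)
    then show ?case by (auto simp: part_Omega oact_add1 split: if_splits)
  qed
qed

lemma omega_scale_add: "omega_scale c (p + q) = omega_scale c p + omega_scale c q"
  "omega_scale c (p - q) = omega_scale c p - omega_scale c q"
  by (cases p; cases q; simp add: omega_scale_def smult_add_right smult_diff_right)+

lemma omega_scale_0: "omega_scale c 0 = 0" by (simp add: omega_scale_def zero_prod_def)

lemma gen_comm:
  assumes "l \<noteq> 0" "a \<in> gpart i" "b \<in> gpart j"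
  shows "oact l \<alpha> (gen_bracket a b) v = omega_gen l \<alpha> a (omega_gen l \<alpha> b v) - omega_scale (koszul i j) (omega_gen l \<alpha> b (omega_gen l \<alpha> a v))"
proof -
  obtain f g where v: "v = (f, g)" by (cases v)
  have poly_ext: "p = q" if "\<And>z. poly p z = poly q z" for p q :: "complex poly"
    using that poly_eq_poly_eq_iff by blast
  have ps: "poly (shift m h) z = poly h (of_int m + z)" for m h z
    by (simp add: shift_def poly_pcompose)
  show ?thesis
    using assms unfolding v
    by (cases i; cases j)
      (auto simp: oact_single omega_scale_def koszul_def power_int_add ps shift_shift algebra_simps intro!: poly_ext split: if_splits,
       (simp add: field_simps power2_eq_square)+)
qed

lemma oact_comm:
  assumes l: "l \<noteq> 0" and "x \<in> part ramond_algebra i" "y \<in> part ramond_algebra j"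
  shows "oact l \<alpha> (rbr x y) v = oact l \<alpha> x (oact l \<alpha> y v) - omega_scale (koszul i j) (oact l \<alpha> y (oact l \<alpha> x v))"
proof -
  have sc: "omega_scale c (omega_scale d p) = omega_scale (c * d) p" for c d p
    by (cases p) (simp add: omega_scale_def)
  have "Poly_Mapping.keys x \<subseteq> gpart i" using assms by (simp add: part_ramond)
  then show ?thesis
  proof (induction x rule: pm_keys_induct)
    case (single a c)
    have "Poly_Mapping.keys y \<subseteq> gpart j" using assms by (simp add: part_ramond)
    then show ?case
    proof (induction y rule: pm_keys_induct)
      case zero then show ?case by (simp add: omega_scale_0)
    next
      case (single b d)
      then show ?case using gen_comm[OF l \<open>a \<in> _\<close> \<open>b \<in> _\<close>, of \<alpha> v]
        by (simp add: rbr_single oact_sc1 oact_single omega_gen_scale omega_scale_add sc mult_ac)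
    qed (auto simp: rbr_add1 rbr_add2 oact_add1 oact_add2 omega_scale_add)
  next
    case zero then show ?case by (simp add: omega_scale_0)
  qed (auto simp: rbr_add1 rbr_add2 oact_add1 oact_add2 omega_scale_add)
qed

lemma supermodule_Omega:
  assumes "l \<noteq> 0"
  shows "supermodule ramond_algebra (Omega l \<alpha>)"
proof -
  have "underlying (Omega l \<alpha>) = UNIV" 
    by (force simp: underlying_def part_Omega)
  then show ?thesis
  unfolding supermodule_def bilinear_on_def scale_ramond scale_Omega
  using superspace_Omega oact_add1 oact_add2 oact_sc1 oact_sc2 oact_part oact_comm[OF assms]
  by (intro conjI allI ballI) blast+
qed


lemma letters_simps [simp]: "letters 0 = []" "letters (u + w) = letters u @ letters w"
  by (simp_all add: zero_free_word_def plus_free_word_def)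

lemma mem_free_algebra: "t \<in> carrier (free_algebra S) \<longleftrightarrow> Poly_Mapping.keys t \<subseteq> {w. set (letters w) \<subseteq> S}"
  by (auto simp: free_algebra_def)

lemma free_algebra_ops:
  "s \<otimes>\<^bsub>free_algebra S\<^esub> t = s * t" "s \<oplus>\<^bsub>free_algebra S\<^esub> t = s + t"
  "\<zero>\<^bsub>free_algebra S\<^esub> = 0" "\<one>\<^bsub>free_algebra S\<^esub> = 1"
  by (simp_all add: free_algebra_def)

lemma ring_free_algebra: "ring (free_algebra S)"
proof -
  have add: "s + t \<in> carrier (free_algebra S)"
    if "s \<in> carrier (free_algebra S)" "t \<in> carrier (free_algebra S)" for s t
    using that Poly_Mapping.keys_add[of s t] by (auto simp: mem_free_algebra)
  have mult: "s * t \<in> carrier (free_algebra S)"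
    if "s \<in> carrier (free_algebra S)" "t \<in> carrier (free_algebra S)" for s t
    using that keys_mult[of s t] by (fastforce simp: mem_free_algebra)
  have neg: "- s \<in> carrier (free_algebra S)" if "s \<in> carrier (free_algebra S)" for s
    using that by (auto simp: mem_free_algebra in_keys_iff)
  have zero: "0 \<in> carrier (free_algebra S)" and one: "1 \<in> carrier (free_algebra S)"
    by (simp_all add: mem_free_algebra)
  note ops = free_algebra_ops
  show ?thesis
  proof (rule ringI)
    show "abelian_group (free_algebra S)"
    proof (rule abelian_groupI; unfold ops)
      fix s assume "s \<in> carrier (free_algebra S)"
      then show "\<exists>y\<in>carrier (free_algebra S). y + s = 0"
        by (intro bexI[OF _ neg]) simp_all
    qed (use zero in \<open>simp_all add: add add_ac\<close>)
    show "Group.monoid (free_algebra S)"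
      by (rule monoidI; unfold ops; simp add: mult one mult.assoc)
  qed (unfold ops, simp_all add: algebra_simps)
qed

lemma supermodule_D:
  assumes "supermodule A M"
  shows "vector_space (scale M)"
    "x \<in> underlying A \<Longrightarrow> act M x (v + w) = act M x v + act M x w"
    "x \<in> underlying A \<Longrightarrow> act M x (scale M c v) = scale M c (act M x v)"
    "x \<in> underlying A \<Longrightarrow> y \<in> underlying A \<Longrightarrow> act M (x + y) v = act M x v + act M y v"
    "x \<in> underlying A \<Longrightarrow> act M (scale A c x) v = scale M c (act M x v)"
    "x \<in> part A i \<Longrightarrow> y \<in> part A j \<Longrightarrow> act M (bracket A x y) v =
       act M x (act M y v) - scale M (koszul i j) (act M y (act M x v))"
  using assms by (auto simp: supermodule_def superspace_def bilinear_on_def)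

lemma foldr_act_linear:
  assumes "supermodule A M" "set xs \<subseteq> underlying A"
  shows "foldr (act M) xs (v + w) = foldr (act M) xs v + foldr (act M) xs w"
    "foldr (act M) xs (scale M c v) = scale M c (foldr (act M) xs v)"
  using assms(2) by (induction xs) (auto simp: supermodule_D[OF assms(1)])

lemma free_algebra_act_eq:
  "free_algebra_act M t v = lin_ext (scale M) (\<lambda>w. foldr (act M) (letters w) v) t"
  by (simp add: free_algebra_act_def lin_ext_def)

lemma fa_act_add:
  assumes "vector_space (scale M)"
  shows "free_algebra_act M (s + t) v = free_algebra_act M s v + free_algebra_act M t v"
   "free_algebra_act M 0 v = 0"
   "free_algebra_act M (s - t) v = free_algebra_act M s v - free_algebra_act M t v"
   "free_algebra_act M (pm_scale c t) v = scale M c (free_algebra_act M t v)"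
proof -
  show *: "free_algebra_act M (s + t) v = free_algebra_act M s v + free_algebra_act M t v" for s t
    by (simp add: free_algebra_act_eq lin_ext_add assms)
  show "free_algebra_act M 0 v = 0" using *[of 0 0] by simp
  show "free_algebra_act M (s - t) v = free_algebra_act M s v - free_algebra_act M t v" 
    using *[of "s - t" t] by (simp add: algebra_simps)
  show "free_algebra_act M (pm_scale c t) v = scale M c (free_algebra_act M t v)"
    by (simp add: free_algebra_act_eq lin_ext_scale assms)
qed

lemma fa_act_linear:
  assumes "supermodule A M" "t \<in> carrier (free_algebra (underlying A))"
  shows "free_algebra_act M t (v + w) = free_algebra_act M t v + free_algebra_act M t w"
    "free_algebra_act M t (scale M c v) = scale M c (free_algebra_act M t v)"
proof -
  note vs = supermodule_D(1)[OF assms(1)]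
  interpret vector_space "scale M" by (rule vs)
  have m: "set (letters u) \<subseteq> underlying A" if "u \<in> Poly_Mapping.keys t" for u
    using assms(2) that by (auto simp: mem_free_algebra)
  show "free_algebra_act M t (v + w) = free_algebra_act M t v + free_algebra_act M t w"
    by (simp add: free_algebra_act_def foldr_act_linear[OF assms(1) m] scale_right_distrib sum.distrib)
  show "free_algebra_act M t (scale M c v) = scale M c (free_algebra_act M t v)"
    by (simp add: free_algebra_act_def foldr_act_linear[OF assms(1) m] scale_sum_right mult.commute)
qed

lemma fa_act_zero:
  assumes "supermodule A M" "t \<in> carrier (free_algebra (underlying A))"
  shows "free_algebra_act M t 0 = 0"
  using fa_act_linear(1)[OF assms, of 0 0] by simp

lemma fa_act_mult:
  assumes "supermodule A M" "s \<in> carrier (free_algebra (underlying A))"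
    "t \<in> carrier (free_algebra (underlying A))"
  shows "free_algebra_act M (s * t) v = free_algebra_act M s (free_algebra_act M t v)"
proof -
  note vs = supermodule_D(1)[OF assms(1)]
  interpret vector_space "scale M" by (rule vs)
  from assms(2)[unfolded mem_free_algebra] show ?thesis
  proof (induction s rule: pm_keys_induct)
    case (single a c)
    from assms(3)[unfolded mem_free_algebra] show ?case
    proof (induction t rule: pm_keys_induct)
      case (single b d)
      then show ?case using \<open>a \<in> _\<close>
        by (simp add: mult_single free_algebra_act_eq vs foldr_act_linear[OF assms(1)])
    next
      case (add x y)
      have "Poly_Mapping.single a c \<in> carrier (free_algebra (underlying A))"
        using single by (simp add: mem_free_algebra)
      with add show ?case by (simp add: fa_act_add[OF vs] distrib_left fa_act_linear[OF assms(1)])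
    next
      case zero
      have "Poly_Mapping.single a c \<in> carrier (free_algebra (underlying A))"
        using single by (simp add: mem_free_algebra)
      then show ?case by (simp add: fa_act_add[OF vs] fa_act_zero[OF assms(1)])
    qed
  qed (simp_all add: fa_act_add[OF vs] distrib_right)
qed

lemma fa_act_letter:
  assumes "vector_space (scale M)"
  shows "free_algebra_act M (letter x) v = act M x v"
proof -
  interpret vector_space "scale M" by fact
  show ?thesis by (simp add: free_algebra_act_eq letter_def assms)
qed

lemma underlying_closed:
  assumes "superspace V" 
  shows "x \<in> underlying V \<Longrightarrow> y \<in> underlying V \<Longrightarrow> x + y \<in> underlying V"
    "x \<in> underlying V \<Longrightarrow> scale V c x \<in> underlying V"
    "x \<in> part V i \<Longrightarrow> x \<in> underlying V"
proof -
  interpret vector_space "scale V" using assms by (simp add: superspace_def)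
  have s: "subspace (part V i)" for i using assms by (simp add: superspace_def)
  show "x \<in> underlying V \<Longrightarrow> y \<in> underlying V \<Longrightarrow> x + y \<in> underlying V"
  proof -
    assume "x \<in> underlying V" "y \<in> underlying V"
    then obtain a b c d where "x = a + b" "y = c + d" "a \<in> part V 0" "c \<in> part V 0"
        "b \<in> part V 1" "d \<in> part V 1" unfolding underlying_def by blast
    then have "x + y = (a + c) + (b + d)" "a + c \<in> part V 0" "b + d \<in> part V 1"
      using s by (auto simp: subspace_add)
    then show ?thesis unfolding underlying_def by blast
  qed
  show "x \<in> underlying V \<Longrightarrow> scale V c x \<in> underlying V"
    unfolding underlying_def using subspace_scale[OF s] by (fastforce simp: scale_right_distrib)
  show "x \<in> part V i \<Longrightarrow> x \<in> underlying V"
    unfolding underlying_def using subspace_0[OF s] by (cases i) force+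
qed

lemma uea_relations_act:
  assumes "lie_superalgebra A" "supermodule A M" "t \<in> uea_relations A"
  shows "t \<in> carrier (free_algebra (underlying A))" "free_algebra_act M t v = 0"
proof -
  let ?F = "free_algebra (underlying A)"
  note vs = supermodule_D(1)[OF assms(2)]
  interpret vector_space "scale M" by (rule vs)
  interpret F: ring ?F by (rule ring_free_algebra)
  have sA: "superspace A" using assms(1) by (simp add: lie_superalgebra_def)
  note U = underlying_closed[OF sA]
  have br: "bracket A x y \<in> underlying A" if "x \<in> part A i" "y \<in> part A j" for x y i j
    by (rule U(3)[of _ "i + j"]) (use that assms(1) in \<open>unfold lie_superalgebra_def, blast\<close>)
  have let_F: "letter x \<in> carrier ?F" if "x \<in> underlying A" for x
    using that by (auto simp: mem_free_algebra letter_def)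
  have mult_F: "s * t \<in> carrier ?F" if "s \<in> carrier ?F" "t \<in> carrier ?F" for s t
    using F.m_closed[OF that] by (simp add: free_algebra_def)
  have minus_F: "s - t \<in> carrier ?F" if "s \<in> carrier ?F" "t \<in> carrier ?F" for s t
    using that keys_diff[of s t] by (auto simp: mem_free_algebra)
  have sc_F: "pm_scale c t \<in> carrier ?F" if "t \<in> carrier ?F" for c t
    using that keys_pm_scale[of c t] by (auto simp: mem_free_algebra)
  consider (add) x y where "x \<in> underlying A" "y \<in> underlying A" "t = letter (x + y) - letter x - letter y"
    | (scale) c x where "x \<in> underlying A" "t = letter (scale A c x) - pm_scale c (letter x)"
    | (bracket) i j x y where "x \<in> part A i" "y \<in> part A j"
        "t = letter x * letter y - pm_scale (koszul i j) (letter y * letter x) - letter (bracket A x y)"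
    using assms(3) unfolding uea_relations_def by blast
  then have "t \<in> carrier ?F \<and> free_algebra_act M t v = 0"
  proof cases
    case add
    then have "x + y \<in> underlying A" by (simp add: U)
    with add show ?thesis
      by (simp add: minus_F let_F fa_act_add[OF vs] fa_act_letter[OF vs] supermodule_D(4)[OF assms(2)])
  next
    case scale
    then have "scale A c x \<in> underlying A" by (simp add: U)
    with scale show ?thesis
      by (simp add: minus_F let_F sc_F fa_act_add[OF vs] fa_act_letter[OF vs] supermodule_D(5)[OF assms(2)])
  next
    case bracket
    then have "x \<in> underlying A" "y \<in> underlying A" "bracket A x y \<in> underlying A"
      using U(3) br by blast+
    with bracket show ?thesis
      by (simp add: minus_F let_F sc_F mult_F fa_act_add[OF vs] fa_act_mult[OF assms(2)] fa_act_letter[OF vs]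
          supermodule_D(6)[OF assms(2) bracket(1,2)])
  qed
  then show "t \<in> carrier ?F" "free_algebra_act M t v = 0" by simp_all
qed

lemma genideal_act:
  assumes "lie_superalgebra A" "supermodule A M"
    and "t \<in> genideal (free_algebra (underlying A)) (uea_relations A)"
  shows "free_algebra_act M t v = 0"
proof -
  let ?F = "free_algebra (underlying A)"
  let ?K = "{t \<in> carrier ?F. \<forall>v. free_algebra_act M t v = 0}"
  note vs = supermodule_D(1)[OF assms(2)]
  interpret vector_space "scale M" by (rule vs)
  interpret F: ring ?F by (rule ring_free_algebra)
  have F_eq: "s \<otimes>\<^bsub>?F\<^esub> t = s * t" "s \<oplus>\<^bsub>?F\<^esub> t = s + t" "\<zero>\<^bsub>?F\<^esub> = 0" for s t by (simp_all add: free_algebra_def)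
  have a_inv: "\<ominus>\<^bsub>?F\<^esub> s = - s" if "s \<in> carrier ?F" for s
    using F.l_neg[OF that] by (simp add: F_eq eq_neg_iff_add_eq_0)
  have "ideal ?K ?F"
  proof (rule idealI)
    show "subgroup ?K (add_monoid ?F)"
    proof (rule F.add.subgroupI)
      fix s assume s: "s \<in> ?K"
      then have "free_algebra_act M (- s) v = 0" for v
        using fa_act_add(3)[OF vs, of 0 s v] fa_act_add(2)[OF vs] by simp
      then show "\<ominus>\<^bsub>?F\<^esub> s \<in> ?K" using s F.a_inv_closed[of s] by (simp add: a_inv)
    next
      show "?K \<noteq> {}" using fa_act_add(2)[OF vs] F.zero_closed by (auto simp: F_eq)
    next
      fix s t assume "s \<in> ?K" "t \<in> ?K"
      then show "s \<oplus>\<^bsub>?F\<^esub> t \<in> ?K" using F.a_closed[of s t] by (simp add: F_eq fa_act_add[OF vs])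
    qed auto
  next
    fix a x assume "a \<in> ?K" "x \<in> carrier ?F"
    then show "x \<otimes>\<^bsub>?F\<^esub> a \<in> ?K" "a \<otimes>\<^bsub>?F\<^esub> x \<in> ?K"
      using F.m_closed[of x a] F.m_closed[of a x]
      by (simp_all add: F_eq fa_act_mult[OF assms(2)] fa_act_zero[OF assms(2)])
  qed (rule F.ring_axioms)
  moreover have "uea_relations A \<subseteq> ?K"
    using uea_relations_act[OF assms(1,2)] by blast
  ultimately have "genideal ?F (uea_relations A) \<subseteq> ?K" by (rule F.genideal_minimal)
  then show ?thesis using assms(3) by blast
qed

lemma uea_act_coset:
  assumes "lie_superalgebra A" "supermodule A M"
    and "t \<in> carrier (free_algebra (underlying A))"
  defines "I \<equiv> genideal (free_algebra (underlying A)) (uea_relations A)"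
  shows "uea_act M (I +>\<^bsub>free_algebra (underlying A)\<^esub> t) v = free_algebra_act M t v"
proof -
  let ?F = "free_algebra (underlying A)"
  interpret F: ring ?F by (rule ring_free_algebra)
  note vs = supermodule_D(1)[OF assms(2)]
  have "uea_relations A \<subseteq> carrier ?F" using uea_relations_act[OF assms(1,2)] by blast
  then have id: "ideal I ?F" unfolding I_def by (rule F.genideal_ideal)
  have "t \<in> I +>\<^bsub>?F\<^esub> t" using abelian_subgroup.a_rcos_self[OF abelian_subgroupI3[OF ideal.axioms(1)[OF id] F.abelian_group_axioms]] assms(3) by blast
  moreover have "free_algebra_act M s v = free_algebra_act M t v" if "s \<in> I +>\<^bsub>?F\<^esub> t" for s
  proof -
    have "s \<in> (\<Union>h\<in>I. {h + t})"
      using that unfolding a_r_coset_def r_coset_def by (simp add: free_algebra_def)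
    then obtain h where "h \<in> I" "s = h + t" by blast
    then show ?thesis using genideal_act[OF assms(1,2), of h v] by (simp add: I_def fa_act_add[OF vs])
  qed
  ultimately have "(\<lambda>t. free_algebra_act M t v) ` (I +>\<^bsub>?F\<^esub> t) = {free_algebra_act M t v}" by blast
  then show ?thesis by (simp add: uea_act_def)
qed

end

theory Submission
  imports Defs
begin

text \<open>
  By freeness every vector is uniquely \<open>f(L\<^sub>0)v + G\<^sub>0 g(L\<^sub>0)v\<close> for a basis vector \<open>v\<close>.  Writing the parity
  involution of \<open>v\<close> in this form as \<open>(f + G\<^sub>0 g)v\<close> gives the norm equation \<open>f\<^sup>2 - t g\<^sup>2 = 1\<close> in \<open>\<complex>[t]\<close>, so
  \<open>g = 0\<close>, \<open>f = \<plusminus>1\<close>, and \<open>v\<close> is homogeneous.  Then \<open>L\<^sub>m v = h\<^sub>m(L\<^sub>0)v\<close> and \<open>G\<^sub>m v = G\<^sub>0 g\<^sub>m(L\<^sub>0)v\<close>, and these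
  polynomials determine the module.  With \<open>k\<^sub>m = 2h\<^sub>m - t g\<^sub>m\<close>, the relations for \<open>[G\<^sub>m, G\<^sub>-\<^sub>m]\<close> and
  \<open>[L\<^sub>m, G\<^sub>-\<^sub>m]\<close> are difference equations whose only polynomial solutions satisfy
  \<open>k\<^sub>m(t) g\<^sub>-\<^sub>m(t + m) = t + const\<close> and \<open>g\<^sub>m(t) g\<^sub>-\<^sub>m(t + m) = 1\<close>.  Hence \<open>g\<^sub>m = c\<^sub>m\<close> is a nonzero constant and
  \<open>k\<^sub>m = c\<^sub>m(t + d\<^sub>m)\<close>; the remaining relations make \<open>c\<close> multiplicative and \<open>d\<close> additive in \<open>m\<close>.
\<close>

section \<open>The polynomial functional equations\<close>

lemma poly_shift [simp]: "poly (shift m f) z = poly f (of_int m + z)"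
  by (simp add: shift_def poly_pcompose)

lemma shift_0: "shift 0 f = f"
  by (simp add: shift_def pcompose_idR)

lemma poly_ext: "(\<And>z. poly p z = poly q z) \<Longrightarrow> p = q" for p q :: "complex poly"
  using poly_eq_poly_eq_iff by blast

text \<open>\<open>p\<close> takes the value \<open>poly p 0\<close> at every
  \<open>of_nat n * c\<close>, so the difference has infinitely many roots.\<close>

lemma poly_periodic_const:
  fixes p :: "complex poly"
  assumes "c \<noteq> 0" and per: "\<And>z. poly p (z + c) = poly p z"
  shows "p = [:poly p 0:]"
proof -
  have *: "poly p (of_nat n * c) = poly p 0" for n
  proof (induction n)
    case (Suc n)
    then show ?case using per[of "of_nat n * c"] by (simp add: algebra_simps)
  qed simp
  have "inj (\<lambda>n::nat. of_nat n * c)"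
    using \<open>c \<noteq> 0\<close> by (auto simp: inj_on_def)
  then have "infinite (range (\<lambda>n::nat. of_nat n * c))"
    by (rule range_inj_infinite)
  moreover have "range (\<lambda>n::nat. of_nat n * c) \<subseteq> {z. poly (p - [:poly p 0:]) z = 0}"
    using * by auto
  ultimately have "infinite {z. poly (p - [:poly p 0:]) z = 0}"
    using finite_subset by blast
  then have "p - [:poly p 0:] = 0"
    using poly_roots_finite by blast
  then show ?thesis by simp
qed

lemma poly_const_of_mult_one:
  fixes p q :: "complex poly"
  assumes "\<And>z. poly p z * poly q z = 1"
  obtains c where "c \<noteq> 0" "p = [:c:]"
proof -
  have "p * q = 1"
    by (rule poly_ext) (simp add: assms)
  then have "p dvd 1" by (metis dvdI)
  then show ?thesis
    using that by (metis is_unit_polyE pCons_0_0 dvd_0_left_iff not_is_unit_0)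
qed

text \<open>The classification with the module stripped away: \<open>GG0\<close> and
  \<open>GG1\<close> come from [G_m, G_n] = 2 L_{m+n} on v and on G_0 v, \<open>LG\<close> from
  [L_m, G_n] on v, and G_m G_0 v = k_m(L_0) v. Taking n = -m makes the right-hand sides
  explicit.\<close>

lemma ramond_structure_polys:
  fixes g h k :: "int \<Rightarrow> complex poly"
  assumes k: "\<And>m. k m = smult 2 (h m) - [:0, 1:] * g m"
    and g0: "g 0 = 1" and h0: "h 0 = [:0, 1:]"
    and GG0: "\<And>m n. k m * shift m (g n) + k n * shift n (g m) = smult 2 (h (m + n))"
    and GG1: "\<And>m n. g m * shift m (k n) + g n * shift n (k m) =
               smult 2 (h (m + n)) + smult (of_int (m + n)) (g (m + n))"
    and LG: "\<And>m n. (h m + smult (of_int m / 2) (g m)) * shift m (g n) - g n * shift n (h m) =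
               smult (of_int m / 2 - of_int n) (g (m + n))"
  obtains l \<alpha> where "l \<noteq> 0" "\<And>m. g m = [:l powi m:]" "\<And>m. h m = smult (l powi m) [:of_int m * \<alpha>, 1:]"
proof -
  have hk: "poly (h m) z = (poly (k m) z + z * poly (g m) z) / 2" for m z
    by (simp add: k)
  have GG0': "poly (k m) z * poly (g n) (of_int m + z) + poly (k n) z * poly (g m) (of_int n + z)
      = 2 * poly (h (m + n)) z" for m n z
    using arg_cong[OF GG0[of m n], of "\<lambda>p. poly p z"] by simp
  have GG1': "poly (g m) z * poly (k n) (of_int m + z) + poly (g n) z * poly (k m) (of_int n + z)
      = 2 * poly (h (m + n)) z + (of_int m + of_int n) * poly (g (m + n)) z" for m n z
    using arg_cong[OF GG1[of m n], of "\<lambda>p. poly p z"] by simp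
  have LG': "(poly (h m) z + of_int m / 2 * poly (g m) z) * poly (g n) (of_int m + z)
      - poly (g n) z * poly (h m) (of_int n + z) = (of_int m / 2 - of_int n) * poly (g (m + n)) z" for m n z
    using arg_cong[OF LG[of m n], of "\<lambda>p. poly p z"] by simp
  have "\<exists>c f. c \<noteq> 0 \<and> g m = [:c:] \<and> k m = smult c [:f, 1:]" for m
  proof (cases "m = 0")
    case True
    then show ?thesis by (intro exI[of _ 1] exI[of _ 0]) (simp add: g0 h0 k)
  next
    case m: False
    \<comment> \<open>This is the polynomial with G_m G_{-m} v = P(L_0) v; \<open>W\<close> has
      \<open>g m\<close> in place of \<open>k m\<close>.\<close>
    define P where "P = k m * shift m (g (- m))"
    define W where "W = g m * shift m (g (- m))"
    \<comment> \<open>Multiplying the recursion for \<open>W\<close> by \<open>t\<close> turns it into a pure difference equation for \<open>V = t(t + m)W\<close>.\<close>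
    define V where "V = [:0, 1:] * [:of_int m, 1:] * W"
    have P: "poly P z = poly (k m) z * poly (g (- m)) (of_int m + z)" for z
      by (simp add: P_def)
    have W: "poly W z = poly (g m) z * poly (g (- m)) (of_int m + z)" for z
      by (simp add: W_def)
    \<comment> \<open>With n = -m, \<open>GG0\<close> at z + m and \<open>GG1\<close> at z share the
      term k_{-m}(z + m) g_m(z), which cancels on subtraction.\<close>
    have Pper: "poly P (z + of_int m) - poly P (z - of_int m) = 2 * of_int m" for z
      using arg_cong2[OF GG0'[of m "z + of_int m" "- m"] GG1'[of m z "- m"], of minus]
      by (simp add: P g0 h0 algebra_simps)
    have P_eq: "P = [:poly P 0, 1:]"
    proof -
      have "P - [:0, 1:] = [:poly (P - [:0, 1:]) 0:]"
      proof (rule poly_periodic_const)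
        show "2 * complex_of_int m \<noteq> 0" using m by simp
        show "poly (P - [:0, 1:]) (z + 2 * of_int m) = poly (P - [:0, 1:]) z" for z
          using Pper[of "z + of_int m"] by (simp add: algebra_simps)
      qed
      then have "P = [:0, 1:] + [:poly P 0:]" by (simp add: algebra_simps)
      then show ?thesis by simp
    qed
    have P1: "poly P z = poly P 0 + z" for z
      by (subst P_eq) simp
    \<comment> \<open>Twice \<open>LG\<close> with n = -m has right-hand side 3m. Substituting 2 h_m
      = k_m + t g_m splits off P(z) - P(z - m) = m and leaves 2m for \<open>W\<close>.\<close>
    have Wrec: "(z + of_int m) * poly W z - (z - of_int m) * poly W (z - of_int m) = 2 * of_int m" for z
    proof -
      have "(z + of_int m) * poly W z - (z - of_int m) * poly W (z - of_int m) =
          2 * ((poly (h m) z + of_int m / 2 * poly (g m) z) * poly (g (- m)) (of_int m + z)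
            - poly (g (- m)) z * poly (h m) (of_int (- m) + z)) - (poly P z - poly P (z - of_int m))"
        unfolding hk P W by (simp add: field_simps)
      also have "\<dots> = 2 * of_int m"
        unfolding LG' using P1[of z] P1[of "z - of_int m"] by (simp add: g0 field_simps)
      finally show ?thesis .
    qed
    \<comment> \<open>The polynomial t(t + m), which is \<open>V\<close> for W = 1, solves the same
      difference equation. Both vanish at 0, so the constant is 0.\<close>
    have "V - [:0, of_int m, 1:] = [:poly (V - [:0, of_int m, 1:]) 0:]"
    proof (rule poly_periodic_const)
      show "complex_of_int m \<noteq> 0" using m by simp
      show "poly (V - [:0, of_int m, 1:]) (z + of_int m) = poly (V - [:0, of_int m, 1:]) z" for z
        using arg_cong[OF Wrec[of "z + of_int m"], of "\<lambda>x. (z + of_int m) * x"]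
        by (simp add: V_def algebra_simps)
    qed
    then have "[:0, 1:] * [:of_int m, 1:] * W = [:0, 1:] * [:of_int m, 1:] * 1"
      by (simp add: V_def)
    then have "W = 1"
      by (metis mult_left_cancel mult_eq_0_iff pCons_eq_0_iff zero_neq_one)
    then have W1: "poly (g m) z * poly (shift m (g (- m))) z = 1" for z
      using W[of z] by simp
    then obtain c where c: "c \<noteq> 0" "g m = [:c:]"
      by (rule poly_const_of_mult_one)
    have "k m = smult c [:poly P 0, 1:]"
    proof (rule poly_ext)
      fix z
      have "poly (k m) z = poly (k m) z * (c * poly (g (- m)) (of_int m + z))"
        using W1[of z] c by simp
      also have "\<dots> = c * poly P z" by (simp add: P)
      finally show "poly (k m) z = poly (smult c [:poly P 0, 1:]) z"
        by (subst (asm) P1) (simp add: algebra_simps)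
    qed
    then show ?thesis using c by blast
  qed
  then obtain c f where c: "\<And>m. c m \<noteq> 0" and gc: "\<And>m. g m = [:c m:]"
    and kc: "\<And>m. k m = smult (c m) [:f m, 1:]" by metis
  have hc: "poly (h m) z = c m * (z + f m / 2)" for m z
    unfolding hk by (simp add: gc kc field_simps)
  \<comment> \<open>Once \<open>g\<close> is constant, \<open>f\<close> drops out of
    \<open>LG\<close> at z = 0, leaving the common factor m/2 - n on both sides.\<close>
  have c_half: "c (m + n) = c m * c n" if "m \<noteq> 2 * n" for m n
  proof -
    have "(of_int m / 2 - of_int n) * c (m + n)
        = (c m * (f m / 2) + of_int m / 2 * c m) * c n - c n * (c m * (of_int n + f m / 2))"
      using LG'[of m 0 n, symmetric] by (simp add: hc gc)
    also have "\<dots> = (of_int m / 2 - of_int n) * (c m * c n)"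
      by (simp add: algebra_simps)
    finally have "(of_int m / 2 - of_int n) * c (m + n) = (of_int m / 2 - of_int n) * (c m * c n)" .
    moreover have "of_int m / 2 - of_int n \<noteq> (0::complex)"
    proof
      assume "of_int m / 2 - of_int n = (0::complex)"
      then have "(of_int m :: complex) = of_int (2 * n)" by simp
      then show False using that by (simp only: of_int_eq_iff)
    qed
    ultimately show ?thesis by simp
  qed
  have c0: "c 0 = 1" using gc[of 0] g0 by (simp add: one_pCons)
  \<comment> \<open>If m = 2n with n nonzero, then n is not 2m, so \<open>c_half\<close> applies
    with the indices exchanged.\<close>
  have c_add: "c (m + n) = c m * c n" for m n
  proof (cases "m = 2 * n")
    case True
    show ?thesis
    proof (cases "n = 0")
      case False
      with True show ?thesis using c_half[of n m] by (simp add: add.commute mult.commute)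
    qed (use True c0 in simp)
  qed (rule c_half)
  \<comment> \<open>This is \<open>GG0\<close> at z = 0, where k_m(0) = c_m f_m and 2 h_{m+n}(0) =
    c_{m+n} f_{m+n}.\<close>
  have f_add: "f (m + n) = f m + f n" for m n
  proof -
    have "c (m + n) * f (m + n) = c (m + n) * (f m + f n)"
      using GG0'[of m 0 n] by (simp add: kc gc hc c_add field_simps)
    then show ?thesis using c by simp
  qed
  have c_pow: "c m = c 1 powi m" for m
  proof (induction m rule: int_induct[of _ 0])
    case base show ?case by (simp add: c0)
  next
    case (step1 i) then show ?case using c by (simp add: c_add power_int_add)
  next
    case (step2 i) 
    have "c i = c (i - 1) * c 1" using c_add[of "i - 1" 1] by simp
    with step2 show ?case using c[of 1] by (simp add: power_int_diff field_simps)
  qed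
  have f_lin: "f m = of_int m * f 1" for m
  proof (induction m rule: int_induct[of _ 0])
    case base show ?case using f_add[of 0 0] by simp
  next
    case (step1 i) then show ?case by (simp add: f_add algebra_simps)
  next
    case (step2 i) 
    have "f i = f (i - 1) + f 1" using f_add[of "i - 1" 1] by simp
    with step2 show ?case by (simp add: algebra_simps)
  qed
  show ?thesis
  proof (rule that[of "c 1" "f 1 / 2"])
    show "h m = smult (c 1 powi m) [:of_int m * (f 1 / 2), 1:]" for m
      by (rule poly_ext) (simp add: hc f_lin[of m] c_pow[of m] algebra_simps)
    show "g m = [:c 1 powi m:]" for m
      by (simp add: gc c_pow[of m])
  qed (rule c)
qed


section \<open>Polynomials in an endomorphism\<close>

text \<open>Horner's scheme for f(T) v. Space and operator are parameters because two cases occur: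
  L_0 on a module, and left multiplication by the letter L_0 in the free algebra.\<close>

definition poly_act ::
  "(complex \<Rightarrow> 'v \<Rightarrow> 'v) \<Rightarrow> ('v \<Rightarrow> 'v) \<Rightarrow> complex poly \<Rightarrow> 'v \<Rightarrow> 'v::ab_group_add" where
  "poly_act s T f v = fold_coeffs (\<lambda>a w. s a v + T w) f 0"

lemma poly_act_0 [simp]: "poly_act s T 0 v = 0"
  by (simp add: poly_act_def)

locale linear_endo = Vector_Spaces.linear s s T
  for s :: "complex \<Rightarrow> 'v \<Rightarrow> 'v::ab_group_add" and T
begin

lemma poly_act_pCons [simp]: "poly_act s T (pCons a f) v = s a v + T (poly_act s T f v)"
  by (cases "f = 0"; cases "a = 0") (simp_all add: poly_act_def zero)

lemma poly_act_1 [simp]: "poly_act s T 1 v = v"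
  by (simp add: one_pCons zero)

lemma poly_act_add_poly: "poly_act s T (f + g) v = poly_act s T f v + poly_act s T g v"
proof (induction f g rule: poly_induct2)
  case (pCons a f b g)
  then show ?case by (simp add: vs1.scale_left_distrib add)
qed simp

lemma poly_act_smult: "poly_act s T (smult c f) v = s c (poly_act s T f v)"
  by (induction f) (simp_all add: vs1.scale_right_distrib scale)

lemma poly_act_diff_poly: "poly_act s T (f - g) v = poly_act s T f v - poly_act s T g v"
  using poly_act_add_poly[of "f - g" g v] by (simp add: algebra_simps)

lemma poly_act_mult: "poly_act s T (f * g) v = poly_act s T f (poly_act s T g v)"
  by (induction f) (simp_all add: mult_pCons_left poly_act_add_poly poly_act_smult)

lemma poly_act_add: "poly_act s T f (v + w) = poly_act s T f v + poly_act s T f w"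
  by (induction f) (simp_all add: vs1.scale_right_distrib add)

lemma poly_act_diff: "poly_act s T f (v - w) = poly_act s T f v - poly_act s T f w"
  using poly_act_add[of f "v - w" w] by (simp add: algebra_simps)

lemma poly_act_in_subspace:
  assumes "vs1.subspace P" "\<And>w. w \<in> P \<Longrightarrow> T w \<in> P" "v \<in> P"
  shows "poly_act s T f v \<in> P"
  by (induction f)
     (use assms in \<open>auto intro: vs1.subspace_0 vs1.subspace_add vs1.subspace_scale\<close>)

text \<open>The source of every \<open>shift\<close>: L_m and G_m move past L_0 at the cost of
  replacing it by L_0 + m, hence past any polynomial in L_0.\<close>

lemma poly_act_shift:
  assumes "Vector_Spaces.linear s s S" "\<And>w. S (T w) = T (S w) + s (of_int m) (S w)"
  shows "S (poly_act s T f v) = poly_act s T (shift m f) (S v)"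
proof -
  interpret S: Vector_Spaces.linear s s S by fact
  show ?thesis
    by (induction f)
       (simp_all add: shift_simps S.zero S.add S.scale assms(2) poly_act_add_poly poly_act_smult
         mult_pCons_left zero add_ac)
qed

end

lemma linear_endoI:
  assumes "vector_space s" "\<And>v w. T (v + w) = T v + T w" "\<And>c v. T (s c v) = s c (T v)"
  shows "linear_endo s T"
proof -
  interpret vector_space s by fact
  show ?thesis by unfold_locales (simp_all add: assms)
qed

section \<open>Modules over the Ramond algebra\<close>

abbreviation ramond_op :: "(ramond, 'm) supermod \<Rightarrow> ramond_gen \<Rightarrow> 'm \<Rightarrow> 'm" where
  "ramond_op M a \<equiv> act M (Poly_Mapping.single a 1)"

text \<open>The orbit map of \<open>v\<close> on the normal forms f(L_0) + G_0 g(L_0) of U(h). Its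
  domain is the space of \<open>Omega\<close>, so for a basis vector \<open>v\<close> it becomes the
  required isomorphism, up to parity.\<close>

definition cartan_map ::
  "(ramond, 'm::ab_group_add) supermod \<Rightarrow> 'm \<Rightarrow> complex poly \<times> complex poly \<Rightarrow> 'm" where
  "cartan_map M v =
     (\<lambda>(f, g). poly_act (scale M) (ramond_op M (L 0)) f v +
        ramond_op M (G 0) (poly_act (scale M) (ramond_op M (L 0)) g v))"

locale ramond_module =
  fixes M :: "(ramond, 'm::ab_group_add) supermod"
  assumes supermodule: "supermodule ramond_algebra M"
begin

abbreviation s where "s \<equiv> scale M"
abbreviation op where "op \<equiv> ramond_op M"

lemmas supermodule_simps = supermodule_D[OF supermodule, unfolded underlying_ramond scale_ramond, simplified]

sublocale vector_space s by (rule supermodule_D(1)[OF supermodule])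

lemma act_single: "act M (Poly_Mapping.single a c) w = s c (op a w)"
  using supermodule_simps(5)[of c "Poly_Mapping.single a 1" w] by simp

lemma act_0: "act M 0 w = 0"
  using supermodule_simps(4)[of 0 0 w] by simp

sublocale op: linear_endo s "op a" for a
  by (rule linear_endoI) (simp_all add: supermodule_simps vector_space_axioms)

text \<open>Every bracket of two generators is a multiple of one generator, so this form covers all
  relations; \<open>koszul\<close> makes it an anticommutator for two odd ones.\<close>

lemma op_commutator:
  assumes "a \<in> gpart i" "b \<in> gpart j" "gen_bracket a b = Poly_Mapping.single e c"
  shows "op a (op b w) = s (koszul i j) (op b (op a w)) + s c (op e w)"
proof -
  have "Poly_Mapping.single a 1 \<in> part ramond_algebra i" "Poly_Mapping.single b 1 \<in> part ramond_algebra j"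
    using assms by (auto simp: part_ramond)
  from supermodule_D(6)[OF supermodule this, of w]
  have "act M (Poly_Mapping.single e c) w = op a (op b w) - s (koszul i j) (op b (op a w))"
    using assms(3) by (simp add: rbr_single)
  then show ?thesis unfolding act_single[of e c] by (simp add: diff_eq_eq add.commute)
qed

lemma op_L_L0: "op (L m) (op (L 0) w) = op (L 0) (op (L m) w) + s (of_int m) (op (L m) w)"
  using op_commutator[of "L m" 0 "L 0" 0 "L m" "of_int m" w] by (simp add: koszul_def)

lemma op_L_G:
  "op (L m) (op (G n) w) = op (G n) (op (L m) w) + s (of_int m / 2 - of_int n) (op (G (m + n)) w)"
  using op_commutator[of "L m" 0 "G n" 1 "G (m + n)" "of_int m / 2 - of_int n" w]
  by (simp add: koszul_def)

lemma op_G_G: "op (G m) (op (G n) w) + op (G n) (op (G m) w) = s 2 (op (L (m + n)) w)"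
  using op_commutator[of "G m" 1 "G n" 1 "L (m + n)" 2 w] by (simp add: koszul_def)

lemma op_G_L0: "op (G m) (op (L 0) w) = op (L 0) (op (G m) w) + s (of_int m) (op (G m) w)"
  using op_L_G[of 0 m w] by simp

lemma op_G0_G0: "op (G 0) (op (G 0) w) = op (L 0) w"
proof -
  have "s 2 (op (G 0) (op (G 0) w)) = s 2 (op (L 0) w)"
    using op_G_G[of 0 0 w] scale_left_distrib[of 1 1 "op (G 0) (op (G 0) w)"] by simp
  then show ?thesis by (simp only: scale_cancel_left) simp
qed

abbreviation P where "P \<equiv> poly_act s (op (L 0))"

lemma L_P: "op (L m) (P f w) = P (shift m f) (op (L m) w)"
  by (rule op.poly_act_shift) (simp_all add: op_L_L0 op.linear_axioms)

lemma G_P: "op (G m) (P f w) = P (shift m f) (op (G m) w)"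
  by (rule op.poly_act_shift) (simp_all add: op_G_L0 op.linear_axioms)

lemma G0_P: "op (G 0) (P f w) = P f (op (G 0) w)"
  by (simp add: G_P shift_0)

lemma op_part:
  assumes "a \<in> gpart i" "w \<in> part M j" shows "op a w \<in> part M (i + j)"
proof -
  have "Poly_Mapping.single a 1 \<in> part ramond_algebra i"
    using assms by (auto simp: part_ramond)
  then show ?thesis using assms(2) supermodule unfolding supermodule_def by blast
qed

lemma subspace_part: "subspace (part M i)"
  using supermodule by (simp add: supermodule_def superspace_def)

lemma part_disjoint: "w \<in> part M i \<Longrightarrow> w \<in> part M (i + 1) \<Longrightarrow> w = 0"
  using supermodule unfolding supermodule_def superspace_def by (cases i) auto

lemma part_decomp: obtains w0 w1 where "w = w0 + w1" "w0 \<in> part M i" "w1 \<in> part M (i + 1)"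
proof -
  have "w \<in> underlying M" using supermodule by (simp add: supermodule_def)
  then obtain w0 w1 where "w = w0 + w1" "w0 \<in> part M 0" "w1 \<in> part M 1"
    unfolding underlying_def by blast
  then show ?thesis using that[of w0 w1] that[of w1 w0] by (cases i) (auto simp: add.commute)
qed

lemma cartan_map_eq: "cartan_map M v (f, g) = P f v + op (G 0) (P g v)"
  by (simp add: cartan_map_def)

lemma cartan_map_add: "cartan_map M v (p + q) = cartan_map M v p + cartan_map M v q"
  by (cases p; cases q) (simp add: cartan_map_eq op.poly_act_add_poly op.add)

lemma cartan_map_scale: "cartan_map M v (omega_scale c p) = s c (cartan_map M v p)"
  by (cases p) (simp add: cartan_map_eq omega_scale_def op.poly_act_smult op.scale scale_right_distrib)

lemma cartan_map_L0: "op (L 0) (cartan_map M v (f, g)) = cartan_map M v ([:0, 1:] * f, [:0, 1:] * g)"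
  using op_G_L0[of 0] by (simp add: cartan_map_eq op.add mult_pCons_left)

lemma cartan_map_G0: "op (G 0) (cartan_map M v (f, g)) = cartan_map M v ([:0, 1:] * g, f)"
  by (simp add: cartan_map_eq op.add op_G0_G0 mult_pCons_left)

end

section \<open>Rank one over the enveloping algebra of the Cartan subalgebra\<close>

lemma mult_pm_scale:
  fixes x t :: "'a free_word \<Rightarrow>\<^sub>0 complex"
  shows "x * pm_scale c t = pm_scale c (x * t)"
proof -
  have "Poly_Mapping.keys x \<subseteq> UNIV" "Poly_Mapping.keys t \<subseteq> UNIV" by simp_all
  then show ?thesis
  proof (induction x rule: pm_keys_induct)
    case (single a d)
    from single(2) show ?case
      by (induction t rule: pm_keys_induct) (simp_all add: mult_single distrib_left pm_scale_add mult_ac)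
  qed (simp_all add: distrib_right pm_scale_add)
qed

lemma linear_endo_letter_mult: "linear_endo pm_scale ((*) (letter x))"
  by (rule linear_endoI) (simp_all add: vs_pm_scale distrib_left mult_pm_scale)

definition L0_poly :: "complex poly \<Rightarrow> ramond free_word \<Rightarrow>\<^sub>0 complex" where
  "L0_poly f = poly_act pm_scale ((*) (letter (Poly_Mapping.single (L 0) 1))) f 1"

text \<open>Representatives in the free algebra of the normal forms in U(h).\<close>

definition cartan_elem :: "complex poly \<times> complex poly \<Rightarrow> ramond free_word \<Rightarrow>\<^sub>0 complex" where
  "cartan_elem = (\<lambda>(f, g). L0_poly f + letter (Poly_Mapping.single (G 0) 1) * L0_poly g)"

lemma L0_poly_pCons:
  "L0_poly (pCons a f) = pm_scale a 1 + letter (Poly_Mapping.single (L 0) 1) * L0_poly f"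
  unfolding L0_poly_def by (rule linear_endo.poly_act_pCons[OF linear_endo_letter_mult])

lemma L0_poly_0: "L0_poly 0 = 0"
  by (simp add: L0_poly_def)

lemma single_in_cartan: "Poly_Mapping.single (L 0) c \<in> underlying cartan"
    "Poly_Mapping.single (G 0) c \<in> underlying cartan"
  using underlying_closed(3)[OF superspace_cartan, of _ 0] underlying_closed(3)[OF superspace_cartan, of _ 1]
  by (auto simp: part_cartan)

lemma free_algebra_closed:
  assumes "s \<in> carrier (free_algebra S)" "t \<in> carrier (free_algebra S)"
  shows "s + t \<in> carrier (free_algebra S)" "s * t \<in> carrier (free_algebra S)"
    "pm_scale c t \<in> carrier (free_algebra S)"
proof -
  interpret F: ring "free_algebra S" by (rule ring_free_algebra)
  show "s + t \<in> carrier (free_algebra S)" "s * t \<in> carrier (free_algebra S)"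
    using F.a_closed[OF assms] F.m_closed[OF assms] by (simp_all add: free_algebra_ops)
  show "pm_scale c t \<in> carrier (free_algebra S)"
    using assms(2) keys_pm_scale[of c t] by (auto simp: mem_free_algebra)
qed

lemma letter_closed: "x \<in> S \<Longrightarrow> letter x \<in> carrier (free_algebra S)"
  by (simp add: letter_def mem_free_algebra)

lemma one_zero_closed: "1 \<in> carrier (free_algebra S)" "0 \<in> carrier (free_algebra S)"
  by (simp_all add: mem_free_algebra)

lemma L0_poly_closed: "L0_poly f \<in> carrier (free_algebra (underlying cartan))"
  by (induction f)
     (simp_all add: L0_poly_0 L0_poly_pCons free_algebra_closed letter_closed one_zero_closed single_in_cartan)

lemma cartan_elem_closed: "cartan_elem p \<in> carrier (free_algebra (underlying cartan))"
  by (cases p) (simp add: cartan_elem_def free_algebra_closed letter_closed single_in_cartan L0_poly_closed)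

lemma fa_act_1: "vector_space (scale M) \<Longrightarrow> free_algebra_act M 1 v = v"
  by (simp add: free_algebra_act_eq vector_space.vector_space_assms(4) flip: single_one)

lemma ramond_module_Omega: "l \<noteq> 0 \<Longrightarrow> ramond_module (Omega l \<alpha>)"
  by unfold_locales (rule supermodule_Omega)

lemma omega_scale_1: "omega_scale 1 p = p"
  by (cases p) (simp add: omega_scale_def)

text \<open>On \<open>Omega\<close>, L_0 multiplies by t and G_0 maps (f, 0) to (0, f), so acting on
  1 recovers the normal form.\<close>

lemma cartan_map_Omega:
  assumes "l \<noteq> 0"
  shows "cartan_map (Omega l \<alpha>) (1, 0) p = p"
proof -
  interpret N: ramond_module "Omega l \<alpha>" by (rule ramond_module_Omega) fact
  have "N.P f (1, 0) = (f, 0)" for f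
  proof (induction f)
    case (pCons a f)
    show ?case unfolding N.op.poly_act_pCons pCons.IH
      by (simp add: oact_single omega_scale_1 omega_scale_def shift_simps(3) shift_0)
  qed (simp add: zero_prod_def)
  then show ?thesis
    by (cases p) (simp add: N.cartan_map_eq oact_single omega_scale_1 shift_simps(3) shift_0)
qed

context ramond_module
begin

lemma fa_act_cartan_elem: "free_algebra_act M (cartan_elem p) v = cartan_map M v p"
proof -
  have M: "supermodule cartan M" using supermodule by (rule supermodule_cartan)
  note simps = fa_act_add[OF vector_space_axioms] fa_act_mult[OF M] fa_act_letter[OF vector_space_axioms]
    fa_act_1[OF vector_space_axioms] letter_closed single_in_cartan L0_poly_closed
  have "free_algebra_act M (L0_poly f) v = P f v" for f
    by (induction f) (simp_all add: L0_poly_0 L0_poly_pCons simps)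
  then show ?thesis
    by (cases p) (simp add: cartan_elem_def cartan_map_eq simps)
qed

text \<open>The spanning half of the normal form theorem: the range is a subspace that contains
  \<open>v\<close> and, since G_0^2 = L_0, is stable under L_0 and G_0.\<close>

lemma fa_act_in_range_cartan_map:
  assumes "t \<in> carrier (free_algebra (underlying cartan))"
  shows "free_algebra_act M t v \<in> range (cartan_map M v)"
proof -
  have add: "x + y \<in> range (cartan_map M v)"
    if "x \<in> range (cartan_map M v)" "y \<in> range (cartan_map M v)" for x y
    using that by (auto simp flip: cartan_map_add)
  have sc: "s c x \<in> range (cartan_map M v)" if "x \<in> range (cartan_map M v)" for c x
    using that by (auto simp flip: cartan_map_scale)
  have op: "op (L 0) x \<in> range (cartan_map M v)" "op (G 0) x \<in> range (cartan_map M v)"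
    if "x \<in> range (cartan_map M v)" for x
    using that by (auto simp: cartan_map_L0 cartan_map_G0)
  have act: "act M z x \<in> range (cartan_map M v)"
    if z: "z \<in> underlying cartan" and x: "x \<in> range (cartan_map M v)" for z x
  proof -
    obtain a b where "z = Poly_Mapping.single (L 0) a + Poly_Mapping.single (G 0) b"
      using z by (auto simp: underlying_cartan)
    then have "act M z x = s a (op (L 0) x) + s b (op (G 0) x)"
      by (simp add: supermodule_simps(4) act_single[of _ a] act_single[of _ b])
    then show ?thesis by (simp only:) (intro add sc op x)
  qed
  have v: "v \<in> range (cartan_map M v)"
    by (rule range_eqI[of _ _ "(1, 0)"]) (simp add: cartan_map_eq op.zero)
  have word: "foldr (act M) xs v \<in> range (cartan_map M v)" if "set xs \<subseteq> underlying cartan" for xs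
    using that by (induction xs) (auto intro: v act)
  show ?thesis using assms[unfolded mem_free_algebra]
  proof (induction t rule: pm_keys_induct)
    case zero
    show ?case using sc[OF v, of 0] by (simp add: fa_act_add[OF vector_space_axioms])
  next
    case (single w c)
    then show ?case by (simp add: free_algebra_act_eq vector_space_axioms sc word)
  qed (simp add: fa_act_add[OF vector_space_axioms] add)
qed

text \<open>The form in which freeness is used later: the quotient algebra is traded for unique
  coordinates (f, g).\<close>

lemma bij_cartan_map:
  assumes "bij_betw (\<lambda>X. uea_act M X v) (carrier (uea cartan)) UNIV"
  shows "bij (cartan_map M v)"
proof (rule bijI)
  let ?F = "free_algebra (underlying cartan)"
  define I where "I = genideal ?F (uea_relations cartan)"
  have carrier: "carrier (uea cartan) = (\<lambda>t. I +>\<^bsub>?F\<^esub> t) ` carrier ?F"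
    by (auto simp: uea_def Let_def FactRing_def A_RCOSETS_def' I_def)
  \<comment> \<open>\<open>N\<close> is arbitrary because both \<open>M\<close> and
    \<open>Omega 1 0\<close> are needed.\<close>
  have uea_act: "uea_act N (I +>\<^bsub>?F\<^esub> t) w = free_algebra_act N t w"
    if "supermodule ramond_algebra N" "t \<in> carrier ?F" for N :: "(ramond, 'n::ab_group_add) supermod" and t w
    unfolding I_def by (rule uea_act_coset[OF lie_superalgebra_cartan supermodule_cartan]) fact+
  show "surj (cartan_map M v)"
  proof
    show "UNIV \<subseteq> range (cartan_map M v)"
    proof
      fix w
      have "w \<in> (\<lambda>X. uea_act M X v) ` carrier (uea cartan)"
        using assms by (simp add: bij_betw_def)
      then obtain t where "t \<in> carrier ?F" "w = uea_act M (I +>\<^bsub>?F\<^esub> t) v"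
        by (auto simp: carrier)
      then show "w \<in> range (cartan_map M v)"
        by (simp add: uea_act[OF supermodule] fa_act_in_range_cartan_map)
    qed
  qed simp
  \<comment> \<open>Acting on \<open>\<Omega>(1, 0)\<close> separates the normal forms modulo the defining ideal; this replaces the PBW theorem.\<close>
  show "inj (cartan_map M v)"
  proof (rule injI)
    fix p q assume eq: "cartan_map M v p = cartan_map M v q"
    let ?X = "\<lambda>p. I +>\<^bsub>?F\<^esub> cartan_elem p"
    have "uea_act M (?X p) v = uea_act M (?X q) v"
      using eq by (simp add: uea_act[OF supermodule] cartan_elem_closed fa_act_cartan_elem)
    moreover have "?X p \<in> carrier (uea cartan)" "?X q \<in> carrier (uea cartan)"
      by (auto simp: carrier cartan_elem_closed)
    ultimately have "?X p = ?X q"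
      using assms by (auto simp: bij_betw_def dest: inj_onD)
    then have "uea_act (Omega 1 0) (?X p) (1, 0) = uea_act (Omega 1 0) (?X q) (1, 0)" by simp
    then show "p = q"
      by (simp add: uea_act[OF supermodule_Omega] cartan_elem_closed cartan_map_Omega
          ramond_module.fa_act_cartan_elem[OF ramond_module_Omega])
  qed
qed

end

section \<open>Homogeneity and classification\<close>

text \<open>The left side is the norm (f + G_0 g)(f - G_0 g). If g is nonzero, t g^2 + 1 has odd
  degree, while f^2 has even degree.\<close>

lemma norm_form_eq_1:
  fixes f g :: "complex poly"
  assumes "f * f - [:0, 1:] * (g * g) = 1"
  shows "g = 0 \<and> (f = 1 \<or> f = - 1)"
proof -
  have ff: "f * f = 1 + [:0, 1:] * (g * g)"
    using assms by (simp add: algebra_simps)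
  have "g = 0"
  proof (rule ccontr)
    assume "g \<noteq> 0"
    then have d: "degree ([:0, 1:] * (g * g)) = 1 + 2 * degree g"
      by (simp add: degree_mult_eq)
    then have "degree (f * f) = 1 + 2 * degree g"
      unfolding ff by (subst degree_add_eq_right) simp_all
    moreover have "degree (f * f) = 2 * degree f"
      by (cases "f = 0") (simp_all add: degree_mult_eq)
    ultimately show False by presburger
  qed
  then show ?thesis using ff by (simp add: square_eq_1_iff)
qed

context ramond_module
begin

lemma P_P: "P f (P g w) = P (f * g) w"
  by (simp add: op.poly_act_mult)

text \<open>The parity involution commutes with L_0 and anticommutes with G_0. If it sends v to (f +
  G_0 g)v, applying it twice gives (f - G_0 g)(f + G_0 g)v = v, the norm equation.\<close>

lemma basis_homogeneous:
  assumes "bij (cartan_map M v)"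
  obtains j where "v \<in> part M j"
proof -
  obtain v0 v1 where v: "v = v0 + v1" "v0 \<in> part M 0" "v1 \<in> part M 1"
    by (rule part_decomp[of v 0]) simp
  obtain f g where fg: "v0 - v1 = P f v + op (G 0) (P g v)"
    using bij_is_surj[OF assms] by (metis cartan_map_eq surj_def surj_pair)
  have P_part: "P h w \<in> part M i" if "w \<in> part M i" for h w i
    using op.poly_act_in_subspace[OF subspace_part _ that] op_part[of "L 0" 0 _ i, unfolded add_0_left] by simp
  have G_part: "op (G 0) w \<in> part M (i + 1)" if "w \<in> part M i" for w i
    using op_part[of "G 0" 1 w i] that by (simp add: add.commute)
  \<comment> \<open>The even and odd components of (f + G_0 g)v - (v0 - v1) = 0; each must
    vanish.\<close>
  let ?e = "P f v0 + op (G 0) (P g v1) - v0"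
  let ?o = "P f v1 + op (G 0) (P g v0) + v1"
  have "?e + ?o = 0"
    using fg by (simp add: v(1) op.poly_act_add op.add algebra_simps)
  moreover have "?e \<in> part M 0"
    using P_part[of v0 0] P_part[of v1 1] G_part[of _ 1] v
    by (intro subspace_diff[OF subspace_part] subspace_add[OF subspace_part]) auto
  moreover have "?o \<in> part M 1"
    using P_part[of v1 1] P_part[of v0 0] G_part[of _ 0] v
    by (intro subspace_add[OF subspace_part]) auto
  ultimately have "?e = 0"
    by (intro part_disjoint[of _ 0, unfolded add_0_left])
       (simp_all only: subspace_neg[OF subspace_part] flip: eq_neg_iff_add_eq_0)
  with \<open>?e + ?o = 0\<close> have e0: "v0 = P f v0 + op (G 0) (P g v1)" and o0: "- v1 = P f v1 + op (G 0) (P g v0)"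
    by (simp_all add: algebra_simps neg_eq_iff_add_eq_0)
  \<comment> \<open>The involution is applied a second time; the cross terms cancel since L_0 and
    G_0 commute.\<close>
  have "v = v0 - (- v1)" by (simp add: v(1))
  also have "\<dots> = (P f v0 + op (G 0) (P g v1)) - (P f v1 + op (G 0) (P g v0))"
    by (simp only: e0[symmetric] o0[symmetric])
  also have "\<dots> = P f (v0 - v1) - op (G 0) (P g (v0 - v1))"
    by (simp add: op.poly_act_diff op.diff)
  also have "\<dots> = P (f * f) v - op (L 0) (P (g * g) v)"
    unfolding fg
    by (simp add: op.poly_act_add op.add P_P G0_P[symmetric] op_G0_G0 mult.commute)
  also have "\<dots> = P (f * f - [:0, 1:] * (g * g)) v"
    by (simp add: op.poly_act_diff_poly)
  finally have "cartan_map M v (f * f - [:0, 1:] * (g * g), 0) = cartan_map M v (1, 0)"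
    by (simp add: cartan_map_eq)
  then have "f * f - [:0, 1:] * (g * g) = 1"
    using bij_is_inj[OF assms] by (simp add: inj_eq)
  then have "g = 0" "f = 1 \<or> f = - 1"
    using norm_form_eq_1 by blast+
  then consider "v0 - v1 = v" | "v0 - v1 = - v"
    using fg by (auto simp: op.zero op.poly_act_diff_poly[of "L 0" 0 1 v, simplified])
  then show ?thesis
  proof cases
    case 1
    have "s 2 v1 = v - (v0 - v1)"
      using scale_left_distrib[of 1 1 v1] by (simp add: v(1))
    then have "v1 = 0" by (simp add: 1)
    then show ?thesis using that[of 0] v by simp
  next
    case 2
    have "s 2 v0 = v0 - v1 + v"
      using scale_left_distrib[of 1 1 v0] by (simp add: v(1))
    then have "v0 = 0" by (simp add: 2)
    then show ?thesis using that[of 1] v by simp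
  qed
qed

end

section \<open>Transport of the action to pairs of polynomials\<close>

context ramond_module
begin

text \<open>A basis vector of parity \<open>j\<close> shifts all parities by \<open>j\<close>,
  whence the parity change. For the reverse inclusion, the component of a preimage with the wrong
  parity is mapped into both parts, hence to 0.\<close>

lemma cartan_map_part:
  assumes "bij (cartan_map M v)" "v \<in> part M j"
  shows "cartan_map M v ` part (Omega l \<alpha>) i = part M (i + j)"
proof -
  have P_part: "P h v \<in> part M j" for h
    using op.poly_act_in_subspace[OF subspace_part _ assms(2)] op_part[of "L 0" 0 _ j, unfolded add_0_left]
    by simp
  have sub: "cartan_map M v p \<in> part M (i + j)" if "p \<in> part (Omega l \<alpha>) i" for p i
    using that P_part op_part[of "G 0" 1 _ j]
    by (cases i) (auto simp: part_Omega cartan_map_eq op.zero)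
  show ?thesis
  proof
    show "part M (i + j) \<subseteq> cartan_map M v ` part (Omega l \<alpha>) i"
    proof
      fix w assume w: "w \<in> part M (i + j)"
      obtain p where p: "w = cartan_map M v p"
        using bij_is_surj[OF assms(1)] by (metis surjD)
      obtain q r where pqr: "p = q + r" "q \<in> part (Omega l \<alpha>) i" "r \<in> part (Omega l \<alpha>) (i + 1)"
      proof (cases p)
        case (Pair f g)
        then show ?thesis using that[of "(f, 0)" "(0, g)"] that[of "(0, g)" "(f, 0)"]
          by (cases i) (simp_all add: part_Omega)
      qed
      have "cartan_map M v r = w - cartan_map M v q"
        by (simp add: p pqr cartan_map_add)
      also have "\<dots> \<in> part M (i + j)"
        by (rule subspace_diff[OF subspace_part w sub[OF pqr(2)]])
      finally have "cartan_map M v r \<in> part M (i + j)" .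
      moreover have "cartan_map M v r \<in> part M (i + j + 1)"
        using sub[OF pqr(3)] by (simp only: ac_simps)
      ultimately have "cartan_map M v r = 0" by (rule part_disjoint)
      then have "w = cartan_map M v q"
        by (simp add: p pqr cartan_map_add)
      with pqr(2) show "w \<in> cartan_map M v ` part (Omega l \<alpha>) i" by blast
    qed
  qed (use sub in blast)
qed

text \<open>By homogeneity the part of parity \<open>j\<close> is C[L_0]v and the other one G_0
  C[L_0]v, so L_m v and G_m v each yield one polynomial. The bracket relations become the hypotheses
  of \<open>ramond_structure_polys\<close>.\<close>

lemma cartan_map_intertwines:
  assumes bij: "bij (cartan_map M v)" and v: "v \<in> part M j"
  obtains l \<alpha> where "l \<noteq> 0" "\<And>a p. op a (cartan_map M v p) = cartan_map M v (omega_gen l \<alpha> a p)"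
proof -
  have even_surj: "\<exists>f. w = P f v" if "w \<in> part M j" for w
  proof -
    have "w \<in> cartan_map M v ` part (Omega 1 0) 0"
      using that by (simp only: cartan_map_part[OF assms] add_0_left)
    then show ?thesis by (auto simp: part_Omega cartan_map_eq op.zero)
  qed
  have odd_surj: "\<exists>f. w = op (G 0) (P f v)" if "w \<in> part M (1 + j)" for w
  proof -
    have "w \<in> cartan_map M v ` part (Omega 1 0) 1"
      using that by (simp only: cartan_map_part[OF assms])
    then show ?thesis by (auto simp: part_Omega cartan_map_eq)
  qed
  have even_inj: "f = f'" if "P f v = P f' v" for f f'
    using that inj_eq[OF bij_is_inj[OF bij], of "(f, 0)" "(f', 0)"] by (simp add: cartan_map_eq op.zero)
  have odd_inj: "f = f'" if "op (G 0) (P f v) = op (G 0) (P f' v)" for f f'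
    using that inj_eq[OF bij_is_inj[OF bij], of "(0, f)" "(0, f')"] by (simp add: cartan_map_eq)
  have "op (L m) v \<in> part M j" for m
    using op_part[of "L m" 0 v j, unfolded add_0_left] v by simp
  then have "\<forall>m. \<exists>f. op (L m) v = P f v"
    using even_surj by blast
  from choice[OF this] obtain h where h: "\<And>m. op (L m) v = P (h m) v"
    by blast
  have "op (G m) v \<in> part M (1 + j)" for m
    using op_part[of "G m" 1 v j] v by simp
  then have "\<forall>m. \<exists>f. op (G m) v = op (G 0) (P f v)"
    using odd_surj by blast
  from choice[OF this] obtain g where g: "\<And>m. op (G m) v = op (G 0) (P (g m) v)"
    by blast
  \<comment> \<open>Since G_m G_0 = 2 L_m - G_0 G_m and G_0^2 = L_0, this is the polynomial of G_m
    G_0 v.\<close>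
  define k where "k = (\<lambda>m. smult 2 (h m) - [:0, 1:] * g m)"
  have L_even: "op (L m) (P f v) = P (h m * shift m f) v" for m f
    by (simp add: L_P h P_P mult.commute)
  have G_even: "op (G m) (P f v) = op (G 0) (P (g m * shift m f) v)" for m f
  proof -
    have "op (G m) (P f v) = P (shift m f) (op (G 0) (P (g m) v))"
      by (simp only: G_P g[of m])
    also have "\<dots> = op (G 0) (P (g m * shift m f) v)"
      by (simp only: G0_P[symmetric] P_P mult.commute)
    finally show ?thesis .
  qed
  have L_odd: "op (L m) (op (G 0) (P f v)) = op (G 0) (P ((h m + smult (of_int m / 2) (g m)) * shift m f) v)" for m f
    by (simp add: op_L_G L_even G_even[of m] op.add op.scale op.poly_act_add_poly op.poly_act_smult distrib_right)
  have G_odd: "op (G m) (op (G 0) (P f v)) = P (k m * shift m f) v" for m f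
  proof -
    have "op (G m) (op (G 0) (P f v)) = s 2 (op (L m) (P f v)) - op (G 0) (op (G m) (P f v))"
      using op_G_G[of m 0 "P f v"] by (simp add: eq_diff_eq)
    also have "\<dots> = P (k m * shift m f) v"
      by (simp add: L_even G_even[of m] op_G0_G0 k_def left_diff_distrib op.poly_act_diff_poly op.poly_act_smult)
    finally show ?thesis .
  qed
  have shift_1: "shift m 1 = 1" for m
    by (rule poly_ext) simp
  have GG0: "k m * shift m (g n) + k n * shift n (g m) = smult 2 (h (m + n))" for m n
    using op_G_G[of m n v]
    by (intro even_inj) (simp add: g[of m] g[of n] h G_odd op.poly_act_add_poly op.poly_act_smult)
  have G_odd_1: "op (G m) (op (G 0) v) = P (k m) v" for m
    using G_odd[of m 1] by (simp add: shift_1)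
  have L_odd_1: "op (L m) (op (G 0) v) = op (G 0) (P (h m + smult (of_int m / 2) (g m)) v)" for m
    using L_odd[of m 1] by (simp add: shift_1)
  have GG1: "g m * shift m (k n) + g n * shift n (k m) =
      smult 2 (h (m + n)) + smult (of_int (m + n)) (g (m + n))" for m n
  proof (rule odd_inj)
    have "op (G 0) (P (g m * shift m (k n) + g n * shift n (k m)) v) =
        op (G m) (op (G n) (op (G 0) v)) + op (G n) (op (G m) (op (G 0) v))"
      by (simp add: G_odd_1 G_even[of m] G_even[of n] op.poly_act_add_poly op.add)
    also have "\<dots> = op (G 0) (P (smult 2 (h (m + n) + smult (of_int (m + n) / 2) (g (m + n)))) v)"
      by (simp only: op_G_G L_odd_1 op.poly_act_smult op.scale)
    finally show "op (G 0) (P (g m * shift m (k n) + g n * shift n (k m)) v) =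
        op (G 0) (P (smult 2 (h (m + n)) + smult (of_int (m + n)) (g (m + n))) v)"
      by (simp add: smult_add_right del: of_int_add)
  qed
  have LG: "(h m + smult (of_int m / 2) (g m)) * shift m (g n) - g n * shift n (h m) =
      smult (of_int m / 2 - of_int n) (g (m + n))" for m n
  proof (rule odd_inj)
    have "op (G 0) (P ((h m + smult (of_int m / 2) (g m)) * shift m (g n)) v) -
        op (G 0) (P (g n * shift n (h m)) v) = s (of_int m / 2 - of_int n) (op (G (m + n)) v)"
      using op_L_G[of m n v] by (simp add: g[of n] h L_odd G_even[of n])
    then show "op (G 0) (P ((h m + smult (of_int m / 2) (g m)) * shift m (g n) - g n * shift n (h m)) v) =
        op (G 0) (P (smult (of_int m / 2 - of_int n) (g (m + n))) v)"
      by (simp only: g[of "m + n"] op.poly_act_diff_poly op.diff op.poly_act_smult op.scale)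
  qed
  have g0: "g 0 = 1"
    using g[of 0] by (intro odd_inj) simp
  have h0: "h 0 = [:0, 1:]"
    using h[of 0] by (intro even_inj) (simp add: op.zero)
  have k: "k m = smult 2 (h m) - [:0, 1:] * g m" for m
    by (simp add: k_def)
  from ramond_structure_polys[OF k g0 h0 GG0 GG1 LG]
  obtain l \<alpha> where l: "l \<noteq> 0" and gl: "\<And>m. g m = [:l powi m:]"
    and hl: "\<And>m. h m = smult (l powi m) [:of_int m * \<alpha>, 1:]"
    by blast
  have kl: "k m = smult (l powi m) [:2 * of_int m * \<alpha>, 1:]" for m
    by (simp add: k_def gl hl)
  have "op a (cartan_map M v p) = cartan_map M v (omega_gen l \<alpha> a p)" for a p
  proof (cases p)
    case (Pair f f')
    show ?thesis
    proof (cases a)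
      case (L m)
      have "h m + smult (of_int m / 2) (g m) = smult (l powi m) [:of_int m * \<alpha> + of_int m / 2, 1:]"
        by (simp add: gl hl algebra_simps)
      then show ?thesis
        by (simp only: L Pair cartan_map_eq op.add L_even L_odd omega_gen.simps) (simp only: hl mult_smult_left)
    next
      case (G m)
      have "g m * q = smult (l powi m) q" for q
        by (simp add: gl)
      then show ?thesis
        by (simp only: G Pair cartan_map_eq op.add G_even[of m] G_odd omega_gen.simps kl mult_smult_left add.commute)
    qed
  qed
  with l show ?thesis by (rule that)
qed

end

text \<open>Reverses direction: \<open>cartan_map\<close> runs from the model to \<open>M\<close>,
  while an isomorphism is defined as a map out of \<open>M\<close>.\<close>

lemma isomorphic_supermodules_inv:
  assumes "Vector_Spaces.linear (scale N) (scale M) \<psi>" "bij \<psi>"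
    and "\<And>i. \<psi> ` part N i = part M i"
    and "\<And>x p. x \<in> underlying A \<Longrightarrow> \<psi> (act N x p) = act M x (\<psi> p)"
  shows "isomorphic_supermodules A M N"
  unfolding isomorphic_supermodules_def
proof (intro exI[of _ "inv_into UNIV \<psi>"] conjI allI ballI)
  interpret \<psi>: Vector_Spaces.linear "scale N" "scale M" \<psi> by fact
  have inv: "inv_into UNIV \<psi> w = p \<longleftrightarrow> w = \<psi> p" for w p
    using \<open>bij \<psi>\<close> by (metis bij_inv_eq_iff)
  have \<psi>_inv: "\<psi> (inv_into UNIV \<psi> w) = w" for w
    using inv[of w "inv_into UNIV \<psi> w"] by simp
  show "Vector_Spaces.linear (scale M) (scale N) (inv_into UNIV \<psi>)"
    by unfold_locales (simp_all add: inv \<psi>.add \<psi>.scale \<psi>_inv)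
  show "bij (inv_into UNIV \<psi>)" using \<open>bij \<psi>\<close> by (rule bij_imp_bij_inv)
  show "inv_into UNIV \<psi> ` part M i = part N i" for i
    using \<open>bij \<psi>\<close> by (simp flip: assms(3) add: bij_is_inj)
  show "inv_into UNIV \<psi> (act M x w) = act N x (inv_into UNIV \<psi> w)" if "x \<in> underlying A" for x w
    by (simp add: inv assms(4)[OF that] \<psi>_inv)
qed

theorem theorem3p4:
  fixes M :: "(ramond, 'm::ab_group_add) supermod"
  assumes "supermodule ramond_algebra M"
    and "uea_free_of_rank_one cartan M"
  shows "\<exists>l \<alpha>. l \<noteq> 0 \<and>
           (isomorphic_supermodules ramond_algebra M (Omega l \<alpha>) \<or>
            isomorphic_supermodules ramond_algebra M (parity_change (Omega l \<alpha>)))"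
proof -
  interpret ramond_module M by unfold_locales (rule assms(1))
  obtain v where bij: "bij (cartan_map M v)"
    using assms(2) bij_cartan_map unfolding uea_free_of_rank_one_def by blast
  then obtain j where v: "v \<in> part M j"
    by (rule basis_homogeneous)
  from bij v obtain l \<alpha> where l: "l \<noteq> 0"
    and comm: "\<And>a p. op a (cartan_map M v p) = cartan_map M v (omega_gen l \<alpha> a p)"
    by (rule cartan_map_intertwines) blast
  have lin: "Vector_Spaces.linear omega_scale s (cartan_map M v)"
  proof -
    interpret \<Omega>: vector_space omega_scale by (rule vs_omega_scale)
    show ?thesis by unfold_locales (simp_all add: cartan_map_add cartan_map_scale)
  qed
  have act: "cartan_map M v (oact l \<alpha> x p) = act M x (cartan_map M v p)" for x p
  proof -
    have "Poly_Mapping.keys x \<subseteq> UNIV" by simp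
    then show ?thesis
    proof (induction x rule: pm_keys_induct)
      case zero
      show ?case using cartan_map_add[of v 0 0] by (simp add: act_0)
    next
      case (single a c)
      show ?case by (simp add: oact_single cartan_map_scale comm act_single[of a c])
    qed (simp add: oact_add1 cartan_map_add supermodule_simps(4))
  qed
  have "isomorphic_supermodules ramond_algebra M
      (if j = 0 then Omega l \<alpha> else parity_change (Omega l \<alpha>))"
  proof (rule isomorphic_supermodules_inv[where \<psi> = "cartan_map M v"])
    \<comment> \<open>For j = 1 the instance i + 1 is the relevant one, since i + 1 + 1 = i for
      parities.\<close>
    show "cartan_map M v ` part (if j = 0 then Omega l \<alpha> else parity_change (Omega l \<alpha>)) i = part M i" for i
      using cartan_map_part[OF bij v, of l \<alpha> i] cartan_map_part[OF bij v, of l \<alpha> "i + 1"]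
      by (cases j) (simp_all add: parity_change_def add.assoc)
  qed (use bij lin act in \<open>simp_all add: parity_change_def\<close>)
  then show ?thesis using l by (auto split: if_splits)
qed

end
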